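(* Given $\alpha>0$ and $1<p<\infty$, let $$\omega_{\alpha,p}=\int_{\{\rho<1\}}\left(\frac{\Phi^0(z)}{\rho}\right)^{\alpha p}dz\,d\sigma,\qquad \sigma_{\alpha,p}=Q\,\omega_{\alpha,p}.$$ Define $C_{\alpha,p}>0$ as follows $$C_{\alpha,p}=\begin{cases}\frac{p-1}{Q-p}\,(\sigma_{\alpha,p})^{-1/(p-1)}, & p\neq Q,\\[4pt] (\sigma_{\alpha,Q})^{-1/(Q-1)}, & p=Q.\end{cases}$$ Then the function $$\mathscr G_{\alpha,p}(z,\sigma)=\begin{cases}C_{\alpha,p}\,\rho(z,\sigma)^{-\frac{Q-p}{p-1}}, & p\neq Q,\\[4pt] C_{\alpha,Q}\,\log\rho(z,\sigma), & p=Q,\end{cases}$$ is a fundamental solution of $-\mathscr L_{\alpha,p}$ with pole in $(0,0)$.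
   Context: A Minkowski norm on $\mathbb{R}^n$ is a function $M:\mathbb{R}^n\to[0,\infty)$ such that $M^2\in C^2(\mathbb{R}^n\setminus\{0\})$ is strictly convex and $M(\lambda x)=|\lambda|M(x)$ for all $x\in\mathbb{R}^n$, $\lambda\in\mathbb{R}$. Its Legendre transform (dual norm) is $M^0(x)=\sup_{M(\xi)=1}\langle x,\xi\rangle$. Let $m,k\ge 1$, $N=m+k$, $\mathbb{R}^N=\mathbb{R}^m\times\mathbb{R}^k$ with points $(z,\sigma)$, $z\in\mathbb{R}^m$, $\sigma\in\mathbb{R}^k$. Let $\Phi\in C^2(\mathbb{R}^m\setminus\{0\})$ and $\Psi\in C^2(\mathbb{R}^k\setminus\{0\})$ be strictly convex Minkowski norms on $\mathbb{R}^m$ and $\mathbb{R}^k$, with dual norms $\Phi^0(z)=\sup_{\Phi(\zeta)=1}\langle z,\zeta\rangle$ and $\Psi^0(\sigma)=\sup_{\Psi(\eta)=1}\langle\sigma,\eta\rangle$. Set $Q=m+(\alpha+1)k$ and $$\rho(z,\sigma)=\Theta^0(z,\sigma)=\left(\Phi^0(z)^{2(\alpha+1)}+4(\alpha+1)^2\Psi^0(\sigma)^2\right)^{\frac{1}{2(\alpha+1)}}.$$ The operator $\mathscr L_{\alpha,p}$ is $$\mathscr L_{\alpha,p}(u)=\operatorname{div}_{(z,\sigma)}\left(\left(\Phi(\nabla_z u)^2+\frac{\Phi^0(z)^{2\alpha}}{4}\Psi(\nabla_\sigma u)^2\right)^{\frac{p-2}{2}}\mathscr A(\nabla_{(z,\sigma)}u)\right),$$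 $$\mathscr A(\nabla_{(z,\sigma)}u)=\begin{pmatrix}\Phi(\nabla_z u)\,\nabla\Phi(\nabla_z u)\\[2pt] \frac{\Phi^0(z)^{2\alpha}}{4}\,\Psi(\nabla_\sigma u)\,\nabla\Psi(\nabla_\sigma u)\end{pmatrix},$$ where $\nabla_z,\nabla_\sigma$ are the Euclidean gradients in $z$ and $\sigma$. That a function $G$ is a fundamental solution of $-\mathscr L_{\alpha,p}$ with pole in $(0,0)$ means that the vector field $\left(\Phi(\nabla_z G)^2+\frac{\Phi^0(z)^{2\alpha}}{4}\Psi(\nabla_\sigma G)^2\right)^{\frac{p-2}{2}}\mathscr A(\nabla_{(z,\sigma)}G)$ belongs to $L^1_{loc}(\mathbb{R}^N)$ and, for every $\varphi\in C_0^\infty(\mathbb{R}^N)$, $$\int_{\mathbb{R}^N}\left(\Phi(\nabla_z G)^2+\frac{\Phi^0(z)^{2\alpha}}{4}\Psi(\nabla_\sigma G)^2\right)^{\frac{p-2}{2}}\langle\mathscr A(\nabla_{(z,\sigma)}G),\nabla_{(z,\sigma)}\varphi\rangle\,dz\,d\sigma=\varphi(0).$$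
   Formalization: For p = Q the function is taken as −C log ρ, since the printed +C log ρ gives −φ(0) in the weak identity; and C > 0 is not asserted, because the printed formula for C is negative when p > Q. *)

theory Defs
  imports "HOL-Analysis.Analysis"
begin

section \<open>Gradients and smoothness\<close>

(* Euclidean gradient; an unspecified vector where f is not differentiable. *)
definition grad :: "('a::euclidean_space \<Rightarrow> real) \<Rightarrow> 'a \<Rightarrow> 'a" where
  "grad f x = (THE D. GDERIV f x :> D)"

definition grad_fst :: "('a::euclidean_space \<times> 'b::euclidean_space \<Rightarrow> real) \<Rightarrow> 'a \<times> 'b \<Rightarrow> 'a" where
  "grad_fst u x = grad (\<lambda>z. u (z, snd x)) (fst x)"

definition grad_snd :: "('a::euclidean_space \<times> 'b::euclidean_space \<Rightarrow> real) \<Rightarrow> 'a \<times> 'b \<Rightarrow> 'b" where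
  "grad_snd u x = grad (\<lambda>\<sigma>. u (fst x, \<sigma>)) (snd x)"

(* Intended for open S: all directional derivatives up to order n exist and are continuous. *)
primrec Ck_on :: "nat \<Rightarrow> ('a::euclidean_space \<Rightarrow> real) \<Rightarrow> 'a set \<Rightarrow> bool" where
  "Ck_on 0 f S \<longleftrightarrow> continuous_on S f"
| "Ck_on (Suc n) f S \<longleftrightarrow>
     (\<forall>x\<in>S. f differentiable (at x)) \<and> (\<forall>v. Ck_on n (\<lambda>x. frechet_derivative f (at x) v) S)"

definition test_function :: "('a::euclidean_space \<Rightarrow> real) \<Rightarrow> bool" where
  "test_function \<phi> \<longleftrightarrow> (\<forall>n. Ck_on n \<phi> UNIV) \<and> compact (closure {x. \<phi> x \<noteq> 0})"

section \<open>Minkowski norms\<close>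

definition strictly_convex_on :: "'a::real_vector set \<Rightarrow> ('a \<Rightarrow> real) \<Rightarrow> bool" where
  "strictly_convex_on S f \<longleftrightarrow> convex S \<and>
     (\<forall>x\<in>S. \<forall>y\<in>S. \<forall>t. x \<noteq> y \<longrightarrow> 0 < t \<longrightarrow> t < 1 \<longrightarrow>
        f ((1 - t) *\<^sub>R x + t *\<^sub>R y) < (1 - t) * f x + t * f y)"

definition minkowski_norm :: "('a::euclidean_space \<Rightarrow> real) \<Rightarrow> bool" where
  "minkowski_norm M \<longleftrightarrow>
     (\<forall>x. 0 \<le> M x) \<and>
     Ck_on 2 (\<lambda>x. (M x)\<^sup>2) (- {0}) \<and>
     strictly_convex_on UNIV (\<lambda>x. (M x)\<^sup>2) \<and>
     (\<forall>x c. M (c *\<^sub>R x) = \<bar>c\<bar> * M x)"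

definition dual_norm :: "('a::euclidean_space \<Rightarrow> real) \<Rightarrow> 'a \<Rightarrow> real" where
  "dual_norm M x = (SUP \<xi>\<in>{\<xi>. M \<xi> = 1}. x \<bullet> \<xi>)"

section \<open>The operator and its fundamental solutions\<close>

definition energy_density ::
  "('a::euclidean_space \<Rightarrow> real) \<Rightarrow> ('b::euclidean_space \<Rightarrow> real) \<Rightarrow> real \<Rightarrow>
   ('a \<times> 'b \<Rightarrow> real) \<Rightarrow> 'a \<times> 'b \<Rightarrow> real" where
  "energy_density \<Phi> \<Psi> \<alpha> u x =
     (\<Phi> (grad_fst u x))\<^sup>2 + dual_norm \<Phi> (fst x) powr (2 * \<alpha>) / 4 * (\<Psi> (grad_snd u x))\<^sup>2"

definition A_field ::
  "('a::euclidean_space \<Rightarrow> real) \<Rightarrow> ('b::euclidean_space \<Rightarrow> real) \<Rightarrow> real \<Rightarrow>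
   ('a \<times> 'b \<Rightarrow> real) \<Rightarrow> 'a \<times> 'b \<Rightarrow> 'a \<times> 'b" where
  "A_field \<Phi> \<Psi> \<alpha> u x =
     (\<Phi> (grad_fst u x) *\<^sub>R grad \<Phi> (grad_fst u x),
      (dual_norm \<Phi> (fst x) powr (2 * \<alpha>) / 4 * \<Psi> (grad_snd u x)) *\<^sub>R grad \<Psi> (grad_snd u x))"

(* The vector field whose divergence is L_{alpha,p}(u).  Where the energy density vanishes both
   coefficients in A_field vanish, so the field is 0 there for every p, whatever value is given to
   a nonpositive power of 0. *)
definition flux ::
  "('a::euclidean_space \<Rightarrow> real) \<Rightarrow> ('b::euclidean_space \<Rightarrow> real) \<Rightarrow> real \<Rightarrow> real \<Rightarrow>
   ('a \<times> 'b \<Rightarrow> real) \<Rightarrow> 'a \<times> 'b \<Rightarrow> 'a \<times> 'b" where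
  "flux \<Phi> \<Psi> \<alpha> p u x = (energy_density \<Phi> \<Psi> \<alpha> u x powr ((p - 2) / 2)) *\<^sub>R A_field \<Phi> \<Psi> \<alpha> u x"

(* G is a fundamental solution of - L_{alpha,p} with pole at the origin.  The first clause makes
   explicit that the gradients in the flux exist almost everywhere; without it they would be
   unspecified vectors. *)
definition fundamental_solution ::
  "('a::euclidean_space \<Rightarrow> real) \<Rightarrow> ('b::euclidean_space \<Rightarrow> real) \<Rightarrow> real \<Rightarrow> real \<Rightarrow>
   ('a \<times> 'b \<Rightarrow> real) \<Rightarrow> bool" where
  "fundamental_solution \<Phi> \<Psi> \<alpha> p G \<longleftrightarrow>
     (AE x in lebesgue. (\<lambda>z. G (z, snd x)) differentiable (at (fst x)) \<and>
                        (\<lambda>\<sigma>. G (fst x, \<sigma>)) differentiable (at (snd x))) \<and>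
     (\<forall>K. compact K \<longrightarrow> flux \<Phi> \<Psi> \<alpha> p G absolutely_integrable_on K) \<and>
     (\<forall>\<phi>. test_function \<phi> \<longrightarrow>
        (LINT x|lebesgue. flux \<Phi> \<Psi> \<alpha> p G x \<bullet> (grad_fst \<phi> x, grad_snd \<phi> x)) = \<phi> 0)"

section \<open>The gauge and the candidate solution\<close>

definition rho ::
  "('a::euclidean_space \<Rightarrow> real) \<Rightarrow> ('b::euclidean_space \<Rightarrow> real) \<Rightarrow> real \<Rightarrow> 'a \<times> 'b \<Rightarrow> real" where
  "rho \<Phi> \<Psi> \<alpha> x =
     (dual_norm \<Phi> (fst x) powr (2 * (\<alpha> + 1)) +
      4 * (\<alpha> + 1)\<^sup>2 * (dual_norm \<Psi> (snd x))\<^sup>2) powr (1 / (2 * (\<alpha> + 1)))"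

definition hom_dim :: "'m::finite itself \<Rightarrow> 'k::finite itself \<Rightarrow> real \<Rightarrow> real" where
  "hom_dim _ _ \<alpha> = real CARD('m) + (\<alpha> + 1) * real CARD('k)"

definition omega_const ::
  "(real ^ 'm \<Rightarrow> real) \<Rightarrow> (real ^ 'k \<Rightarrow> real) \<Rightarrow> real \<Rightarrow> real \<Rightarrow> real" where
  "omega_const \<Phi> \<Psi> \<alpha> p =
     (LINT x:{x. rho \<Phi> \<Psi> \<alpha> x < 1}|lebesgue. (dual_norm \<Phi> (fst x) / rho \<Phi> \<Psi> \<alpha> x) powr (\<alpha> * p))"

definition sigma_const ::
  "(real ^ 'm \<Rightarrow> real) \<Rightarrow> (real ^ 'k \<Rightarrow> real) \<Rightarrow> real \<Rightarrow> real \<Rightarrow> real" where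
  "sigma_const \<Phi> \<Psi> \<alpha> p = hom_dim TYPE('m) TYPE('k) \<alpha> * omega_const \<Phi> \<Psi> \<alpha> p"

(* Positive for p \<le> Q, negative for p > Q. *)
definition C_const ::
  "(real ^ 'm \<Rightarrow> real) \<Rightarrow> (real ^ 'k \<Rightarrow> real) \<Rightarrow> real \<Rightarrow> real \<Rightarrow> real" where
  "C_const \<Phi> \<Psi> \<alpha> p =
     (let Q = hom_dim TYPE('m) TYPE('k) \<alpha> in
      if p \<noteq> Q then (p - 1) / (Q - p) * sigma_const \<Phi> \<Psi> \<alpha> p powr (- 1 / (p - 1))
      else sigma_const \<Phi> \<Psi> \<alpha> Q powr (- 1 / (Q - 1)))"

(* For p = Q the sign must be negative, as in the classical - log |x| / (2 pi) for the Laplacian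
   in the plane.  The source prints C log rho, a solution of - L u = - delta for its C > 0. *)
definition G_fun ::
  "(real ^ 'm \<Rightarrow> real) \<Rightarrow> (real ^ 'k \<Rightarrow> real) \<Rightarrow> real \<Rightarrow> real \<Rightarrow> (real ^ 'm) \<times> (real ^ 'k) \<Rightarrow> real" where
  "G_fun \<Phi> \<Psi> \<alpha> p x =
     (let Q = hom_dim TYPE('m) TYPE('k) \<alpha> in
      if p \<noteq> Q then C_const \<Phi> \<Psi> \<alpha> p * rho \<Phi> \<Psi> \<alpha> x powr (- (Q - p) / (p - 1))
      else - C_const \<Phi> \<Psi> \<alpha> Q * ln (rho \<Phi> \<Psi> \<alpha> x))"

end

theory Submission
  imports Defs
begin

text \<open>
  Let \<open>\<delta>\<^sub>s (z, \<sigma>) = (s z, s powr (\<alpha> + 1) \<sigma>)\<close> be the dilations adapted to the operator; they scale volume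
  by \<open>s powr Q\<close>, the gauge \<open>\<rho>\<close> satisfies \<open>\<rho> (\<delta>\<^sub>s x) = s \<rho> x\<close>, and their generator is the vector field
  \<open>X = (z, (\<alpha> + 1) \<sigma>)\<close>. Two facts make \<open>G\<close> a fundamental solution.

  The flux of a function \<open>g \<circ> \<rho>\<close> points along \<open>X\<close>. A dual norm is differentiable off the origin, its
  gradient at \<open>z\<close> is the unique maximiser \<open>\<xi>\<close> in its definition (\<open>dual_norm_GDERIV\<close>), and the
  gradient of the Minkowski norm at a multiple of \<open>\<xi>\<close> is in turn a multiple of \<open>z\<close>
  (\<open>minkowski_grad_at_maximiser\<close>). With the exponents in \<open>\<rho>\<close> the energy density of \<open>\<rho>\<close> becomes
  \<open>(\<Phi>\<^sup>0 z / \<rho>) powr (2 * \<alpha>)\<close>, and the flux of \<open>g \<circ> \<rho>\<close> is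
  \<open>\<bar>g'\<bar> powr (p - 2) * g' * h / \<rho>\<close> times \<open>X\<close>, where \<open>h = (\<Phi>\<^sup>0 z / \<rho>) powr (\<alpha> * p)\<close> is constant on the orbits
  of the dilations (\<open>flux_radial\<close>). The profile of \<open>G\<close> is chosen so that this equals
  \<open>- 1 / S * h * \<rho> powr -Q\<close> times \<open>X\<close>, with \<open>S = Q * \<omega>\<close>.

  It remains to show that the integral of \<open>h * \<rho> powr -Q\<close> times the derivative of \<open>\<phi>\<close> along \<open>X\<close> is
  \<open>- S * \<phi> 0\<close>. The measure \<open>\<rho> powr -Q dx\<close> is the image of \<open>Q dx ds / s\<close> on
  \<open>{\<rho> x < 1} \<times> {s > 0}\<close> under \<open>(x, s) \<mapsto> \<delta>\<^sub>s x\<close> (\<open>polar_measure\<close>), a form of polar coordinates that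
  avoids surface measures and needs only Tonelli's theorem and the scaling of volume. At \<open>\<delta>\<^sub>s x\<close>
  the derivative of \<open>\<phi>\<close> along \<open>X\<close>, divided by \<open>s\<close>, is the derivative of \<open>\<phi> (\<delta>\<^sub>s x)\<close> in \<open>s\<close>, whose
  integral over \<open>s > 0\<close> is \<open>- \<phi> 0\<close> (\<open>integral_along_dilation\<close>). The integral of \<open>Q * h\<close> over the unit
  ball is \<open>S\<close>.
  The same coordinates show that \<open>\<rho> powr -Q\<close> times \<open>X\<close> is locally integrable (\<open>integrable_rho_powr\<close>).
\<close>

section \<open>Gradients\<close>

lemma grad_eqI:
  assumes "GDERIV f x :> D"
  shows "grad f x = D"
  unfolding grad_def
proof (rule the_equality)
  fix E assume "GDERIV f x :> E"
  then have "(\<lambda>h. inner h E) = (\<lambda>h. inner h D)"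
    using assms unfolding gderiv_def by (rule has_derivative_unique)
  then show "E = D" by (metis vector_eq_ldot inner_commute)
qed (use assms in simp)

text \<open>The derivative, a linear functional, is represented by the vector with coordinates \<open>f' b\<close>.\<close>

lemma grad_inner:
  assumes "(f has_derivative f') (at x)"
  shows "v \<bullet> grad f x = f' v"
proof -
  have lin: "linear f'" using assms has_derivative_linear by blast
  have "f' v = v \<bullet> (\<Sum>b\<in>Basis. f' b *\<^sub>R b)" for v
  proof -
    have "f' v = f' (\<Sum>b\<in>Basis. (v \<bullet> b) *\<^sub>R b)" by (simp add: euclidean_representation)
    also have "\<dots> = (\<Sum>b\<in>Basis. (v \<bullet> b) * f' b)"
      unfolding linear_sum[OF lin] linear_scale[OF lin] real_scaleR_def ..
    finally show ?thesis by (simp add: inner_sum_right mult.commute)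
  qed
  note * = this
  have "GDERIV f x :> (\<Sum>b\<in>Basis. f' b *\<^sub>R b)"
    using assms unfolding gderiv_def by (rule has_derivative_eq_rhs) (rule ext, rule *)
  from grad_eqI[OF this] have "v \<bullet> grad f x = v \<bullet> (\<Sum>b\<in>Basis. f' b *\<^sub>R b)" by (rule arg_cong)
  also have "\<dots> = f' v" by (rule *[symmetric])
  finally show ?thesis .
qed

lemma inner_partial_gradients:
  fixes \<phi> :: "'a::euclidean_space \<times> 'b::euclidean_space \<Rightarrow> real"
  assumes \<phi>: "(\<phi> has_derivative \<phi>') (at x)"
  shows "v \<bullet> (grad_fst \<phi> x, grad_snd \<phi> x) = \<phi>' v"
proof -
  have "((\<lambda>z. (z, snd x)) has_derivative (\<lambda>h. (h, 0))) (at (fst x))"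
    by (auto intro!: derivative_eq_intros)
  from has_derivative_compose[OF this, of \<phi> \<phi>'] \<phi>
  have "((\<lambda>z. \<phi> (z, snd x)) has_derivative (\<lambda>h. \<phi>' (h, 0))) (at (fst x))" by simp
  moreover have "((\<lambda>\<sigma>. (fst x, \<sigma>)) has_derivative (\<lambda>h. (0, h))) (at (snd x))"
    by (auto intro!: derivative_eq_intros)
  from has_derivative_compose[OF this, of \<phi> \<phi>'] \<phi>
  have "((\<lambda>\<sigma>. \<phi> (fst x, \<sigma>)) has_derivative (\<lambda>h. \<phi>' (0, h))) (at (snd x))" by simp
  ultimately have "v \<bullet> (grad_fst \<phi> x, grad_snd \<phi> x) = \<phi>' (fst v, 0) + \<phi>' (0, snd v)"
    unfolding grad_fst_def grad_snd_def inner_prod_def by (simp add: grad_inner)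
  also have "\<dots> = \<phi>' v"
    using linear_add[OF has_derivative_linear[OF \<phi>], of "(fst v, 0)" "(0, snd v)"] by simp
  finally show ?thesis .
qed

section \<open>Minkowski norms\<close>

lemma minkowski_scale: "minkowski_norm M \<Longrightarrow> M (c *\<^sub>R x) = \<bar>c\<bar> * M x"
  by (simp add: minkowski_norm_def)

lemma minkowski_nonneg: "minkowski_norm M \<Longrightarrow> 0 \<le> M x"
  by (simp add: minkowski_norm_def)

lemma minkowski_zero: "minkowski_norm M \<Longrightarrow> M 0 = 0"
  using minkowski_scale[of M 0 0] by simp

lemma minkowski_midpoint:
  assumes "minkowski_norm M" "x \<noteq> y"
  shows "(M ((1/2) *\<^sub>R (x + y)))\<^sup>2 < ((M x)\<^sup>2 + (M y)\<^sup>2) / 2"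
proof -
  have "strictly_convex_on UNIV (\<lambda>x. (M x)\<^sup>2)"
    using assms(1) unfolding minkowski_norm_def by blast
  from this[unfolded strictly_convex_on_def] assms(2)
  have "(M ((1 - 1/2) *\<^sub>R x + (1/2) *\<^sub>R y))\<^sup>2 < (1 - 1/2) * (M x)\<^sup>2 + (1/2) * (M y)\<^sup>2"
    by (elim conjE) (drule bspec[of _ _ x], simp, drule bspec[of _ _ y], simp, drule spec[of _ "1/2"], simp)
  then show ?thesis by (simp add: scaleR_add_right)
qed

lemma minkowski_pos:
  assumes "minkowski_norm M" "x \<noteq> 0"
  shows "0 < M x"
proof (rule ccontr)
  assume "\<not> 0 < M x"
  then have "M x = 0" using minkowski_nonneg[OF assms(1), of x] by linarith
  then show False
    using minkowski_midpoint[OF assms] minkowski_zero[OF assms(1)] by simp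
qed

text \<open>A positive continuous function has a positive minimum and a maximum on the Euclidean unit sphere,
  and homogeneity carries both bounds to the whole space. Continuity away from the origin comes from
  the smoothness of \<open>M\<^sup>2\<close>.\<close>

lemma minkowski_bounds:
  assumes "minkowski_norm M"
  obtains c C where "0 < c" "0 < C" "\<And>x. c * norm x \<le> M x" "\<And>x. M x \<le> C * norm x"
proof -
  let ?S = "sphere 0 1 :: 'a set"
  have "Ck_on 2 (\<lambda>x. (M x)\<^sup>2) (- {0})"
    using assms unfolding minkowski_norm_def by blast
  then have "\<forall>x\<in>-{0}. (\<lambda>x. (M x)\<^sup>2) differentiable (at x)"
    by (simp add: numeral_2_eq_2)
  then have "continuous_on ?S (\<lambda>x. (M x)\<^sup>2)"
    by (intro continuous_at_imp_continuous_on) (auto intro: differentiable_imp_continuous_within)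
  then have "continuous_on ?S (\<lambda>x. sqrt ((M x)\<^sup>2))"
    by (rule continuous_on_real_sqrt)
  moreover have "(\<lambda>x. sqrt ((M x)\<^sup>2)) = M"
    using minkowski_nonneg[OF assms] by (simp add: fun_eq_iff)
  ultimately have cont: "continuous_on ?S M" by metis
  have ne: "?S \<noteq> {}" by simp
  obtain a where a: "a \<in> ?S" "\<And>y. y \<in> ?S \<Longrightarrow> M a \<le> M y"
    using continuous_attains_inf[OF compact_sphere ne cont] by blast
  obtain b where b: "b \<in> ?S" "\<And>y. y \<in> ?S \<Longrightarrow> M y \<le> M b"
    using continuous_attains_sup[OF compact_sphere ne cont] by blast
  have scal: "M x = norm x * M (sgn x)" for x
    using minkowski_scale[OF assms, of "norm x" "sgn x"]
    by (cases "x = 0") (simp_all add: sgn_div_norm minkowski_zero[OF assms])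
  show thesis
  proof (rule that)
    show "0 < M a" "0 < M b"
      using a(1) b(1) minkowski_pos[OF assms, of a] minkowski_pos[OF assms, of b] by force+
    show "M a * norm x \<le> M x" for x
      using mult_right_mono[OF a(2)[of "sgn x"] norm_ge_zero[of x]] scal[of x]
      by (cases "x = 0") (simp_all add: minkowski_zero[OF assms] norm_sgn mult.commute)
    show "M x \<le> M b * norm x" for x
      using mult_right_mono[OF b(2)[of "sgn x"] norm_ge_zero[of x]] scal[of x]
      by (cases "x = 0") (simp_all add: minkowski_zero[OF assms] norm_sgn mult.commute)
  qed
qed

lemma minkowski_continuous:
  assumes "minkowski_norm M"
  shows "continuous_on UNIV M"
proof (rule continuous_at_imp_continuous_on, rule ballI)
  fix x :: 'a
  show "isCont M x"
  proof (cases "x = 0")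
    case True
    obtain c C where C: "\<And>x. M x \<le> C * norm x"
      using minkowski_bounds[OF assms] by metis
    have "(M \<longlongrightarrow> 0) (at 0)"
    proof (rule tendsto_sandwich[of "\<lambda>_. 0" _ _ "\<lambda>x. C * norm x"])
      show "((\<lambda>x. C * norm x) \<longlongrightarrow> 0) (at 0)" by (auto intro!: tendsto_eq_intros)
    qed (use C minkowski_nonneg[OF assms] in auto)
    then show ?thesis by (simp add: True isCont_def minkowski_zero[OF assms])
  next
    case False
    have "Ck_on 2 (\<lambda>x. (M x)\<^sup>2) (- {0})"
      using assms unfolding minkowski_norm_def by blast
    then have "(\<lambda>x. (M x)\<^sup>2) differentiable (at x)"
      using False by (simp add: numeral_2_eq_2)
    then have "isCont (\<lambda>x. (M x)\<^sup>2) x"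
      by (rule differentiable_imp_continuous_within)
    then have "isCont (\<lambda>x. sqrt ((M x)\<^sup>2)) x"
      by (rule continuous_real_sqrt)
    moreover have "(\<lambda>x. sqrt ((M x)\<^sup>2)) = M"
      using minkowski_nonneg[OF assms] by (simp add: fun_eq_iff)
    ultimately show ?thesis by metis
  qed
qed

lemma compact_minkowski_sphere:
  assumes "minkowski_norm M"
  shows "compact {\<xi>. M \<xi> = 1}"
proof (rule compact_eq_bounded_closed[THEN iffD2, OF conjI])
  obtain c C where c: "0 < c" "\<And>x. c * norm x \<le> M x"
    using minkowski_bounds[OF assms] by metis
  show "bounded {\<xi>. M \<xi> = 1}"
    unfolding bounded_iff
    by (rule exI[of _ "1/c"]) (use c in \<open>auto simp: field_simps\<close>, metis mult.commute)
  show "closed {\<xi>. M \<xi> = 1}"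
    using continuous_closed_preimage_constant[OF minkowski_continuous[OF assms], of 1] by simp
qed

section \<open>Dual norms\<close>

lemma dual_norm_attained:
  assumes "minkowski_norm M"
  obtains \<xi> where "M \<xi> = 1" "dual_norm M x = x \<bullet> \<xi>" "\<And>\<eta>. M \<eta> = 1 \<Longrightarrow> x \<bullet> \<eta> \<le> dual_norm M x"
proof -
  obtain e :: 'a where "norm e = 1" using vector_choose_size[of 1] by auto
  then have "e \<noteq> 0" by auto
  then have "M ((1 / M e) *\<^sub>R e) = 1"
    using minkowski_pos[OF assms, of e] by (simp add: minkowski_scale[OF assms])
  then have ne: "{\<xi>. M \<xi> = 1} \<noteq> {}" by blast
  obtain \<xi> where \<xi>: "M \<xi> = 1" "\<And>\<eta>. M \<eta> = 1 \<Longrightarrow> x \<bullet> \<eta> \<le> x \<bullet> \<xi>"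
    using continuous_attains_sup[OF compact_minkowski_sphere[OF assms] ne, of "\<lambda>\<xi>. x \<bullet> \<xi>"]
      continuous_on_inner[OF continuous_on_const continuous_on_id, of "{\<xi>. M \<xi> = 1}" x]
    by auto
  have "dual_norm M x = x \<bullet> \<xi>"
    unfolding dual_norm_def by (rule cSup_eq_maximum) (use \<xi> in auto)
  with \<xi> show thesis by (intro that) auto
qed

lemma inner_le_dual_norm:
  assumes "minkowski_norm M"
  shows "x \<bullet> \<xi> \<le> dual_norm M x * M \<xi>"
proof (cases "\<xi> = 0")
  case False
  then have "M ((1 / M \<xi>) *\<^sub>R \<xi>) = 1"
    using minkowski_pos[OF assms, of \<xi>] by (simp add: minkowski_scale[OF assms])
  then have "x \<bullet> ((1 / M \<xi>) *\<^sub>R \<xi>) \<le> dual_norm M x"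
    using dual_norm_attained[OF assms, of x] by metis
  then show ?thesis using minkowski_pos[OF assms False] by (simp add: field_simps)
qed (simp add: minkowski_zero[OF assms])

lemma dual_norm_pos:
  assumes "minkowski_norm M" "x \<noteq> 0"
  shows "0 < dual_norm M x"
proof -
  have "0 < x \<bullet> x" using assms(2) by simp
  also have "\<dots> \<le> dual_norm M x * M x" by (rule inner_le_dual_norm[OF assms(1)])
  finally show ?thesis using minkowski_pos[OF assms] by (simp add: zero_less_mult_iff)
qed

lemma dual_norm_scale:
  assumes "minkowski_norm M" "0 \<le> t"
  shows "dual_norm M (t *\<^sub>R x) = t * dual_norm M x"
proof (rule antisym)
  obtain \<xi> where "M \<xi> = 1" "dual_norm M (t *\<^sub>R x) = t *\<^sub>R x \<bullet> \<xi>"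
    using dual_norm_attained[OF assms(1)] by metis
  then show "dual_norm M (t *\<^sub>R x) \<le> t * dual_norm M x"
    using inner_le_dual_norm[OF assms(1), of x \<xi>] assms(2) by (simp add: mult_left_mono)
  obtain \<eta> where "M \<eta> = 1" "dual_norm M x = x \<bullet> \<eta>"
    using dual_norm_attained[OF assms(1)] by metis
  then show "t * dual_norm M x \<le> dual_norm M (t *\<^sub>R x)"
    using inner_le_dual_norm[OF assms(1), of "t *\<^sub>R x" \<eta>] by simp
qed

lemma dual_norm_zero: "minkowski_norm M \<Longrightarrow> dual_norm M 0 = 0"
  using dual_norm_scale[of M 0 0] by simp

lemma dual_norm_nonneg: "minkowski_norm M \<Longrightarrow> 0 \<le> dual_norm M x"
  using dual_norm_pos[of M x] dual_norm_zero[of M] by (cases "x = 0") auto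

lemma norm_le_dual_norm:
  assumes "minkowski_norm M"
  obtains C where "0 < C" "\<And>x. norm x \<le> C * dual_norm M x"
proof -
  obtain c C where C: "0 < C" "\<And>x. M x \<le> C * norm x"
    using minkowski_bounds[OF assms] by metis
  have "norm x \<le> C * dual_norm M x" for x
  proof (cases "x = 0")
    case False
    have "norm x * norm x = x \<bullet> x" by (simp add: dot_square_norm power2_eq_square)
    also have "\<dots> \<le> dual_norm M x * M x" by (rule inner_le_dual_norm[OF assms])
    also have "\<dots> \<le> dual_norm M x * (C * norm x)"
      by (intro mult_left_mono C dual_norm_nonneg[OF assms])
    finally have "norm x * norm x \<le> (C * dual_norm M x) * norm x" by (simp add: ac_simps)
    then show ?thesis using False by simp
  qed (simp add: dual_norm_zero[OF assms])
  with C show thesis by (intro that)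
qed

text \<open>At the midpoint of two distinct maximisers \<open>M\<close> is smaller than \<open>1\<close> by strict convexity of \<open>M\<^sup>2\<close>,
  while the linear functional still has its maximal value there; rescaling the midpoint to \<open>M = 1\<close>
  would exceed the maximum.\<close>

lemma dual_norm_maximiser_unique:
  assumes "minkowski_norm M" "x \<noteq> 0"
    and "M \<xi> = 1" "x \<bullet> \<xi> = dual_norm M x" "M \<eta> = 1" "x \<bullet> \<eta> = dual_norm M x"
  shows "\<xi> = \<eta>"
proof (rule ccontr)
  assume "\<xi> \<noteq> \<eta>"
  let ?m = "(1/2) *\<^sub>R (\<xi> + \<eta>)"
  have "(M ?m)\<^sup>2 < 1\<^sup>2"
    using minkowski_midpoint[OF assms(1) \<open>\<xi> \<noteq> \<eta>\<close>] assms by simp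
  then have "M ?m < 1" by (rule power2_less_imp_less) simp
  moreover have "dual_norm M x = x \<bullet> ?m" using assms by (simp add: inner_add_right)
  ultimately show False
    using inner_le_dual_norm[OF assms(1), of x ?m] dual_norm_pos[OF assms(1,2)]
    by (metis mult.right_neutral mult_less_cancel_left_pos not_less)
qed

text \<open>Envelope theorem. If \<open>\<eta>\<close> is the maximiser at \<open>y\<close>, then comparing \<open>\<xi>\<close> and \<open>\<eta>\<close> as competitors at
  \<open>y\<close> and at \<open>x\<close> gives
  \<open>0 \<le> dual_norm M y - dual_norm M x - (y - x) \<bullet> \<xi> \<le> (y - x) \<bullet> (\<eta> - \<xi>)\<close>.
  Since the maximiser at \<open>x\<close> is unique and the sphere \<open>M = 1\<close> is compact, \<open>\<eta>\<close> tends to \<open>\<xi>\<close> as \<open>y\<close>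
  tends to \<open>x\<close>, so the remainder is of smaller order than \<open>y - x\<close>.\<close>

lemma dual_norm_GDERIV:
  assumes M: "minkowski_norm M" and "x \<noteq> 0" and \<xi>: "M \<xi> = 1" "x \<bullet> \<xi> = dual_norm M x"
  shows "GDERIV (dual_norm M) x :> \<xi>"
proof -
  obtain c C where c: "0 < c" "\<And>x. c * norm x \<le> M x"
    using minkowski_bounds[OF M] by metis
  define B where "B = 1 / c"
  have "B > 0" using c by (simp add: B_def)
  have B: "norm \<eta> \<le> B" if "M \<eta> = 1" for \<eta>
    using c(1) c(2)[of \<eta>] that by (simp add: B_def field_simps)
  have "\<exists>d>0. \<forall>y. norm (y - x) < d \<longrightarrow>
          norm (dual_norm M y - dual_norm M x - (y - x) \<bullet> \<xi>) \<le> e * norm (y - x)" if e: "e > 0" for e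
  proof -
    let ?K = "{\<eta>. M \<eta> = 1} \<inter> {\<eta>. e \<le> norm (\<eta> - \<xi>)}"
    have "closed {\<eta>. e \<le> norm (\<eta> - \<xi>)}"
      by (intro closed_Collect_le continuous_intros)
    then have K: "compact ?K" by (intro compact_Int_closed compact_minkowski_sphere M)
    \<comment> \<open>points of the sphere at distance at least \<open>e\<close> from \<open>\<xi>\<close> miss the maximum by a fixed gap \<open>\<mu>\<close>\<close>
    obtain \<mu> where \<mu>: "\<mu> > 0" "\<And>\<eta>. \<eta> \<in> ?K \<Longrightarrow> x \<bullet> \<eta> \<le> dual_norm M x - \<mu>"
    proof (cases "?K = {}")
      case False
      obtain \<zeta> where \<zeta>: "\<zeta> \<in> ?K" "\<And>\<eta>. \<eta> \<in> ?K \<Longrightarrow> x \<bullet> \<eta> \<le> x \<bullet> \<zeta>"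
        using continuous_attains_sup[OF K False, of "\<lambda>\<eta>. x \<bullet> \<eta>"]
          continuous_on_inner[OF continuous_on_const continuous_on_id, of ?K x]
        by blast
      have "M \<zeta> = 1" "\<zeta> \<noteq> \<xi>" using \<zeta>(1) e by auto
      then have "x \<bullet> \<zeta> \<noteq> dual_norm M x"
        using dual_norm_maximiser_unique[OF M \<open>x \<noteq> 0\<close> \<xi>, of \<zeta>] by metis
      then have "x \<bullet> \<zeta> < dual_norm M x"
        using inner_le_dual_norm[OF M, of x \<zeta>] \<open>M \<zeta> = 1\<close> by simp
      show ?thesis
      proof (rule that)
        show "0 < dual_norm M x - x \<bullet> \<zeta>"
          using \<open>x \<bullet> \<zeta> < dual_norm M x\<close> by simp
        show "x \<bullet> \<eta> \<le> dual_norm M x - (dual_norm M x - x \<bullet> \<zeta>)" if "\<eta> \<in> ?K" for \<eta>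
          using \<zeta>(2)[OF that] by simp
      qed
    next
      case True
      show ?thesis
      proof (rule that[of 1])
        show "x \<bullet> \<eta> \<le> dual_norm M x - 1" if "\<eta> \<in> ?K" for \<eta>
          using that True by blast
      qed simp
    qed
    show ?thesis
    proof (intro exI conjI allI impI)
      show "0 < \<mu> / (2 * B)" using \<mu>(1) \<open>B > 0\<close> by simp
      fix y assume y: "norm (y - x) < \<mu> / (2 * B)"
      obtain \<eta> where \<eta>: "M \<eta> = 1" "dual_norm M y = y \<bullet> \<eta>"
        using dual_norm_attained[OF M] by metis
      have lo: "y \<bullet> \<xi> \<le> dual_norm M y" "x \<bullet> \<eta> \<le> dual_norm M x"
        using inner_le_dual_norm[OF M, of y \<xi>] inner_le_dual_norm[OF M, of x \<eta>] \<xi> \<eta> by auto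
      have est: "\<bar>(y - x) \<bullet> \<zeta>\<bar> < \<mu> / 2" if "M \<zeta> = 1" for \<zeta>
      proof -
        have "\<bar>(y - x) \<bullet> \<zeta>\<bar> \<le> norm (y - x) * norm \<zeta>" by (rule Cauchy_Schwarz_ineq2)
        also have "\<dots> \<le> norm (y - x) * B" by (intro mult_left_mono B that) simp
        also have "\<dots> < \<mu> / (2 * B) * B" using y \<open>B > 0\<close> by (intro mult_strict_right_mono)
        finally show ?thesis using \<open>B > 0\<close> by simp
      qed
      have "norm (\<eta> - \<xi>) < e"
      proof (rule ccontr)
        assume "\<not> ?thesis"
        then have "\<eta> \<in> ?K" using \<eta>(1) by simp
        then have "x \<bullet> \<eta> \<le> dual_norm M x - \<mu>" by (rule \<mu>(2))
        then show False
          using est[OF \<eta>(1)] est[OF \<xi>(1)] lo(1) \<xi>(2) \<eta>(2)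
          unfolding inner_diff_left abs_less_iff by linarith
      qed
      have "0 \<le> dual_norm M y - dual_norm M x - (y - x) \<bullet> \<xi>"
        using lo(1) \<xi>(2) unfolding inner_diff_left by linarith
      moreover have "dual_norm M y - dual_norm M x - (y - x) \<bullet> \<xi> \<le> (y - x) \<bullet> (\<eta> - \<xi>)"
        using lo(2) \<eta>(2) unfolding inner_diff_left inner_diff_right by linarith
      moreover have "(y - x) \<bullet> (\<eta> - \<xi>) \<le> norm (y - x) * norm (\<eta> - \<xi>)"
        by (rule norm_cauchy_schwarz)
      moreover have "norm (y - x) * norm (\<eta> - \<xi>) \<le> norm (y - x) * e"
        using \<open>norm (\<eta> - \<xi>) < e\<close> by (intro mult_left_mono) auto
      ultimately show "norm (dual_norm M y - dual_norm M x - (y - x) \<bullet> \<xi>) \<le> e * norm (y - x)"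
        unfolding mult.commute[of e] real_norm_def by linarith
    qed
  qed
  then show ?thesis
    unfolding gderiv_def has_derivative_at_alt by (auto intro: bounded_linear_inner_left)
qed

lemma dual_norm_continuous:
  assumes "minkowski_norm M"
  shows "continuous_on UNIV (dual_norm M)"
proof -
  obtain c C where c: "0 < c" "\<And>x. c * norm x \<le> M x"
    using minkowski_bounds[OF assms] by metis
  have "dual_norm M y - dual_norm M x \<le> 1 / c * norm (y - x)" for x y
  proof -
    obtain \<eta> where \<eta>: "M \<eta> = 1" "dual_norm M y = y \<bullet> \<eta>"
      using dual_norm_attained[OF assms] by metis
    have "dual_norm M y - dual_norm M x \<le> (y - x) \<bullet> \<eta>"
      using inner_le_dual_norm[OF assms, of x \<eta>] \<eta> by (simp add: inner_diff_left)
    also have "\<dots> \<le> norm (y - x) * norm \<eta>" by (rule norm_cauchy_schwarz)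
    also have "\<dots> \<le> norm (y - x) * (1 / c)"
      using c(1) c(2)[of \<eta>] \<eta> by (intro mult_left_mono) (auto simp: field_simps)
    finally show ?thesis by (simp add: mult.commute)
  qed
  from this this have "dist (dual_norm M x) (dual_norm M y) \<le> 1 / c * dist x y" for x y
    unfolding dist_norm real_norm_def
    by (metis abs_le_iff minus_diff_eq norm_minus_commute)
  then have "(1 / c)-lipschitz_on UNIV (dual_norm M)"
    using c by (intro lipschitz_onI) auto
  then show ?thesis by (rule lipschitz_on_continuous_on)
qed

text \<open>By duality \<open>dual_norm M x * M y - sgn c * (x \<bullet> y)\<close> is nonnegative, and it vanishes at
  \<open>y = c *\<^sub>R \<xi>\<close>. Its derivative is therefore zero at that point, which determines the gradient of
  \<open>M\<close> there. For \<open>c = 0\<close> the gradient is unspecified, but it is multiplied by \<open>M 0 = 0\<close>.\<close>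

lemma minkowski_grad_at_maximiser:
  assumes M: "minkowski_norm M" and diff: "\<And>y. y \<noteq> 0 \<Longrightarrow> M differentiable (at y)"
    and "x \<noteq> 0" and \<xi>: "M \<xi> = 1" "x \<bullet> \<xi> = dual_norm M x"
  shows "M (c *\<^sub>R \<xi>) *\<^sub>R grad M (c *\<^sub>R \<xi>) = (c / dual_norm M x) *\<^sub>R x"
proof (cases "c = 0")
  case False
  let ?d = "dual_norm M x"
  have d: "?d > 0" by (rule dual_norm_pos[OF M \<open>x \<noteq> 0\<close>])
  have "c *\<^sub>R \<xi> \<noteq> 0" using \<xi> False minkowski_zero[OF M] by auto
  then obtain M' where M': "(M has_derivative M') (at (c *\<^sub>R \<xi>))"
    using diff unfolding differentiable_def by blast
  define F where "F y = ?d * M y - sgn c * (x \<bullet> y)" for y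
  have "(F has_derivative (\<lambda>h. ?d * M' h - sgn c * (x \<bullet> h))) (at (c *\<^sub>R \<xi>))"
    unfolding F_def by (auto intro!: derivative_eq_intros M')
  moreover have "F (c *\<^sub>R \<xi>) \<le> F y" for y
  proof -
    have "M (sgn c *\<^sub>R y) = M y" using False by (simp add: minkowski_scale[OF M] sgn_real_def)
    then have "0 \<le> F y"
      using inner_le_dual_norm[OF M, of x "sgn c *\<^sub>R y"] unfolding F_def by simp
    moreover have "F (c *\<^sub>R \<xi>) = 0"
      unfolding F_def using \<xi> by (simp add: minkowski_scale[OF M] abs_sgn algebra_simps)
    ultimately show ?thesis by simp
  qed
  ultimately have "(\<lambda>h. ?d * M' h - sgn c * (x \<bullet> h)) = (\<lambda>h. 0)"
    by (intro differential_zero_maxmin[of "c *\<^sub>R \<xi>" UNIV F]) auto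
  then have "M' h = h \<bullet> ((sgn c / ?d) *\<^sub>R x)" for h
    using d by (drule_tac fun_cong[of _ _ h]) (simp add: field_simps inner_commute)
  then have "GDERIV M (c *\<^sub>R \<xi>) :> (sgn c / ?d) *\<^sub>R x"
    using M' unfolding gderiv_def by presburger
  then have "grad M (c *\<^sub>R \<xi>) = (sgn c / ?d) *\<^sub>R x" by (rule grad_eqI)
  then show ?thesis
    using \<xi> by (simp add: minkowski_scale[OF M] abs_sgn mult.commute)
qed (use minkowski_zero[OF M] in simp)

section \<open>Polar coordinates for anisotropic dilations\<close>

definition dilation :: "real \<Rightarrow> real \<Rightarrow> 'a::euclidean_space \<times> 'b::euclidean_space \<Rightarrow> 'a \<times> 'b" where
  "dilation \<alpha> s x = (s *\<^sub>R fst x, (s powr (\<alpha> + 1)) *\<^sub>R snd x)"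

lemma dilation_measurable [measurable]:
  "(\<lambda>(x :: 'a::euclidean_space \<times> 'b::euclidean_space, s). dilation \<alpha> s x) \<in> borel_measurable (borel \<Otimes>\<^sub>M borel)"
  "(\<lambda>p :: ('a \<times> 'b) \<times> real. dilation \<alpha> (snd p) (fst p)) \<in> borel_measurable (borel \<Otimes>\<^sub>M borel)"
  "(dilation \<alpha> s :: 'a \<times> 'b \<Rightarrow> _) \<in> borel_measurable borel"
proof -
  have [measurable]: "(fst :: 'a \<times> 'b \<Rightarrow> 'a) \<in> borel_measurable borel"
    "(snd :: 'a \<times> 'b \<Rightarrow> 'b) \<in> borel_measurable borel"
    by (intro borel_measurable_continuous_onI continuous_intros)+
  show *: "(\<lambda>p :: ('a \<times> 'b) \<times> real. dilation \<alpha> (snd p) (fst p)) \<in> borel_measurable (borel \<Otimes>\<^sub>M borel)"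
    unfolding dilation_def by (intro borel_measurable_Pair) measurable
  then show "(\<lambda>(x :: 'a \<times> 'b, s). dilation \<alpha> s x) \<in> borel_measurable (borel \<Otimes>\<^sub>M borel)"
    by (simp add: case_prod_beta')
  show "(dilation \<alpha> s :: 'a \<times> 'b \<Rightarrow> _) \<in> borel_measurable borel"
    unfolding dilation_def[abs_def] by (intro borel_measurable_Pair) measurable
qed

text \<open>A dilation is a diagonal linear map; its determinant is \<open>s\<close> once for each coordinate of the first factor
  and \<open>s powr (\<alpha> + 1)\<close> once for each coordinate of the second, whence the exponent.\<close>

lemma nn_integral_dilation:
  fixes f :: "'a::euclidean_space \<times> 'b::euclidean_space \<Rightarrow> ennreal" and \<alpha> s :: real
  assumes f[measurable]: "f \<in> borel_measurable borel" and "0 < s"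
  shows "(\<integral>\<^sup>+x. f x \<partial>lborel) =
    ennreal (s powr (DIM('a) + (\<alpha> + 1) * DIM('b))) * (\<integral>\<^sup>+x. f (dilation \<alpha> s x) \<partial>lborel)"
proof -
  define c where "c j = (if snd j = 0 then s else s powr (\<alpha> + 1))" for j :: "'a \<times> 'b"
  have c: "c j > 0" for j using \<open>0 < s\<close> by (simp add: c_def)
  have T: "0 + (\<Sum>j\<in>Basis. (c j * (x \<bullet> j)) *\<^sub>R j) = dilation \<alpha> s x" for x
  proof (rule euclidean_eqI)
    fix b :: "'a \<times> 'b" assume b: "b \<in> Basis"
    then have "(0 + (\<Sum>j\<in>Basis. (c j * (x \<bullet> j)) *\<^sub>R j)) \<bullet> b = c b * (x \<bullet> b)"
      by simp
    also have "\<dots> = dilation \<alpha> s x \<bullet> b"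
      using b by (auto simp: Basis_prod_def c_def dilation_def inner_prod_def)
    finally show "(0 + (\<Sum>j\<in>Basis. (c j * (x \<bullet> j)) *\<^sub>R j)) \<bullet> b = dilation \<alpha> s x \<bullet> b" .
  qed
  have "(\<Prod>j\<in>Basis. \<bar>c j\<bar>) = (\<Prod>i\<in>Basis. \<bar>c (i, 0)\<bar>) * (\<Prod>i\<in>Basis. \<bar>c (0, i)\<bar>)"
    unfolding Basis_prod_def
    by (subst prod.union_disjoint) (auto simp: prod.reindex inj_on_def)
  also have "\<dots> = (\<Prod>i\<in>(Basis::'a set). s) * (\<Prod>i\<in>(Basis::'b set). s powr (\<alpha> + 1))"
    using \<open>0 < s\<close>
    by (intro arg_cong2[of _ _ _ _ "(*)"] prod.cong) (auto simp: c_def nonzero_Basis)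
  also have "\<dots> = s powr (DIM('a) + (\<alpha> + 1) * DIM('b))"
    using \<open>0 < s\<close> by (simp add: powr_add[of s "real DIM('a)"] powr_realpow[symmetric] powr_powr)
  finally have J: "(\<Prod>j\<in>Basis. \<bar>c j\<bar>) = s powr (DIM('a) + (\<alpha> + 1) * DIM('b))" .
  have "(lborel :: ('a \<times> 'b) measure) = density (distr lborel borel (dilation \<alpha> s))
      (\<lambda>_. ennreal (s powr (DIM('a) + (\<alpha> + 1) * DIM('b))))"
    by (rule lborel_affine_euclidean[of c 0, unfolded T J]) (rule less_imp_neq[OF c, symmetric])
  then have "(\<integral>\<^sup>+x. f x \<partial>lborel) = (\<integral>\<^sup>+x. f x \<partial>density (distr lborel borel (dilation \<alpha> s))
      (\<lambda>_. ennreal (s powr (DIM('a) + (\<alpha> + 1) * DIM('b)))))"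
    by simp
  also have "\<dots> = ennreal (s powr (DIM('a) + (\<alpha> + 1) * DIM('b))) * (\<integral>\<^sup>+x. f (dilation \<alpha> s x) \<partial>lborel)"
    by (simp add: nn_integral_density nn_integral_distr nn_integral_cmult)
  finally show ?thesis .
qed

lemma nn_integral_powr_tail:
  fixes r Q :: real
  assumes "0 < r" "0 < Q"
  shows "(\<integral>\<^sup>+s. ennreal (Q * s powr (-1 - Q)) * indicator {r<..} s \<partial>lborel) = ennreal (r powr -Q)"
proof -
  have "(\<integral>\<^sup>+s. ennreal (Q * s powr (-1 - Q)) * indicator {r<..} s \<partial>lborel)
      = (\<integral>\<^sup>+s. ennreal (Q * s powr (-1 - Q)) * indicator {r..} s \<partial>lborel)"
    using AE_lborel_singleton[of r] by (intro nn_integral_cong_AE) (auto split: split_indicator)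
  also have "\<dots> = ennreal (0 - (- (r powr -Q)))"
  proof (rule nn_integral_FTC_atLeast)
    fix s assume "r \<le> s"
    then show "((\<lambda>s. - (s powr -Q)) has_real_derivative Q * s powr (-1 - Q)) (at s)"
      using assms by (auto intro!: derivative_eq_intros) (simp add: powr_diff powr_minus field_simps)
    show "0 \<le> Q * s powr (-1 - Q)" using assms by simp
  next
    have "((\<lambda>s. s powr -Q) \<longlongrightarrow> 0) at_top"
      using assms by (intro tendsto_neg_powr filterlim_ident) auto
    then show "((\<lambda>s. - (s powr -Q)) \<longlongrightarrow> 0) at_top"
      using tendsto_minus by fastforce
  qed auto
  finally show ?thesis by simp
qed

text \<open>The density of \<open>Q dx ds / s\<close> on the pairs of a point of the unit ball of a gauge and a positive
  scale. Mapping \<open>(x, s)\<close> to the dilate of \<open>x\<close> by \<open>s\<close> turns it into polar coordinates without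
  any surface measure; each point \<open>y\<close> is hit once for every positive scale \<open>s > r y\<close>.\<close>

definition polar_density :: "('c \<Rightarrow> real) \<Rightarrow> real \<Rightarrow> 'c \<times> real \<Rightarrow> real" where
  "polar_density r Q = (\<lambda>(x, s). Q * indicator {x. r x < 1} x * indicator {0<..} s / s)"

lemma polar_density_measurable [measurable]:
  assumes [measurable]: "r \<in> borel_measurable borel"
  shows "polar_density r Q \<in> borel_measurable (borel \<Otimes>\<^sub>M borel)"
  unfolding polar_density_def by measurable

text \<open>Integrate over \<open>x\<close> first. The substitution \<open>y = dilation \<alpha> s x\<close> has Jacobian \<open>s powr -Q\<close> on the
  right and turns \<open>r x < 1\<close> into \<open>r y < s\<close>. After exchanging the integrals, the scales
  contribute the integral of \<open>Q * s powr (-1 - Q)\<close> over \<open>s > r y\<close>, which is \<open>r y powr -Q\<close>.\<close>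

lemma nn_integral_polar:
  fixes f :: "'a::euclidean_space \<times> 'b::euclidean_space \<Rightarrow> ennreal" and r :: "'a \<times> 'b \<Rightarrow> real"
    and \<alpha> Q :: real
  assumes f[measurable]: "f \<in> borel_measurable borel"
    and r[measurable]: "r \<in> borel_measurable borel"
    and hom: "\<And>s x. 0 < s \<Longrightarrow> r (dilation \<alpha> s x) = s * r x"
    and pos: "AE x in lborel. 0 < r x"
    and Q: "Q = DIM('a) + (\<alpha> + 1) * DIM('b)" "0 < Q"
  shows "(\<integral>\<^sup>+x. ennreal (r x powr -Q) * f x \<partial>lborel) =
    (\<integral>\<^sup>+p. ennreal (polar_density r Q p) * f (dilation \<alpha> (snd p) (fst p)) \<partial>(lborel \<Otimes>\<^sub>M lborel))"
proof -
  let ?g = "\<lambda>x s. ennreal (polar_density r Q (x, s)) * f (dilation \<alpha> s x)"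
  have "(\<integral>\<^sup>+p. ennreal (polar_density r Q p) * f (dilation \<alpha> (snd p) (fst p)) \<partial>(lborel \<Otimes>\<^sub>M lborel))
      = (\<integral>\<^sup>+s. \<integral>\<^sup>+x. ?g x s \<partial>lborel \<partial>lborel)"
    by (subst lborel_pair.nn_integral_snd[symmetric])
       (auto simp: case_prod_beta' intro!: borel_measurable_times_ennreal)
  also have "\<dots> = (\<integral>\<^sup>+s. \<integral>\<^sup>+y. (ennreal (Q * s powr (-1 - Q)) * indicator {0<..} s) *
      (indicator {y. r y < s} y * f y) \<partial>lborel \<partial>lborel)"
  proof (rule nn_integral_cong)
    fix s :: real
    show "(\<integral>\<^sup>+x. ?g x s \<partial>lborel) = (\<integral>\<^sup>+y. (ennreal (Q * s powr (-1 - Q)) * indicator {0<..} s) *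
      (indicator {y. r y < s} y * f y) \<partial>lborel)"
    proof (cases "0 < s")
      case True
      have "(\<integral>\<^sup>+x. ?g x s \<partial>lborel) =
          (\<integral>\<^sup>+x. ennreal (Q / s) * (indicator {y. r y < s} (dilation \<alpha> s x) * f (dilation \<alpha> s x)) \<partial>lborel)"
        using True by (intro nn_integral_cong)
          (auto simp: polar_density_def hom split: split_indicator)
      also have "\<dots> = ennreal (Q / s) * (\<integral>\<^sup>+x. indicator {y. r y < s} (dilation \<alpha> s x) * f (dilation \<alpha> s x) \<partial>lborel)"
        by (rule nn_integral_cmult) measurable
      also have "\<dots> = ennreal (Q * s powr (-1 - Q)) *
         (ennreal (s powr Q) * (\<integral>\<^sup>+x. indicator {y. r y < s} (dilation \<alpha> s x) * f (dilation \<alpha> s x) \<partial>lborel))"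
      proof -
        have "Q / s = Q * s powr (-1 - Q) * s powr Q"
          using True by (simp add: powr_add[symmetric] powr_minus field_simps)
        then show ?thesis
          using Q by (simp add: ennreal_mult mult.assoc)
      qed
      also have "ennreal (s powr Q) * (\<integral>\<^sup>+x. indicator {y. r y < s} (dilation \<alpha> s x) * f (dilation \<alpha> s x) \<partial>lborel)
         = (\<integral>\<^sup>+y. indicator {y. r y < s} y * f y \<partial>lborel)"
        unfolding Q(1) by (rule nn_integral_dilation[symmetric]) (use True in measurable)
      finally show ?thesis using True by (simp add: nn_integral_cmult)
    qed (simp add: polar_density_def)
  qed
  also have "\<dots> = (\<integral>\<^sup>+y. \<integral>\<^sup>+s. (ennreal (Q * s powr (-1 - Q)) * indicator {0<..} s) *
      (indicator {y. r y < s} y * f y) \<partial>lborel \<partial>lborel)"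
    by (rule lborel_pair.Fubini') measurable
  also have "\<dots> = (\<integral>\<^sup>+x. ennreal (r x powr -Q) * f x \<partial>lborel)"
  proof (rule nn_integral_cong_AE, use pos in eventually_elim)
    fix y assume y: "0 < r y"
    have "(\<integral>\<^sup>+s. (ennreal (Q * s powr (-1 - Q)) * indicator {0<..} s) * (indicator {y. r y < s} y * f y) \<partial>lborel)
       = (\<integral>\<^sup>+s. (ennreal (Q * s powr (-1 - Q)) * indicator {r y<..} s) * f y \<partial>lborel)"
      using y by (intro nn_integral_cong) (auto split: split_indicator)
    also have "\<dots> = ennreal (r y powr -Q) * f y"
      by (subst nn_integral_multc) (auto simp: nn_integral_powr_tail[OF y Q(2)])
    finally show "(\<integral>\<^sup>+s. (ennreal (Q * s powr (-1 - Q)) * indicator {0<..} s) * (indicator {y. r y < s} y * f y) \<partial>lborel)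
       = ennreal (r y powr -Q) * f y" .
  qed
  finally show ?thesis ..
qed

lemma polar_measure:
  fixes r :: "'a::euclidean_space \<times> 'b::euclidean_space \<Rightarrow> real" and \<alpha> Q :: real
  assumes r[measurable]: "r \<in> borel_measurable borel"
    and hom: "\<And>s x. 0 < s \<Longrightarrow> r (dilation \<alpha> s x) = s * r x"
    and pos: "AE x in lborel. 0 < r x"
    and Q: "Q = DIM('a) + (\<alpha> + 1) * DIM('b)" "0 < Q"
  shows "density lborel (\<lambda>x. ennreal (r x powr -Q)) =
    distr (density (lborel \<Otimes>\<^sub>M lborel) (\<lambda>p. ennreal (polar_density r Q p))) borel
      (\<lambda>p. dilation \<alpha> (snd p) (fst p))"
proof (rule measure_eqI)
  let ?P = "borel \<Otimes>\<^sub>M borel :: (('a \<times> 'b) \<times> real) measure"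
  fix A assume "A \<in> sets (density lborel (\<lambda>x. ennreal (r x powr -Q)))"
  then have A[measurable]: "A \<in> sets borel" by simp
  have "(\<lambda>p. dilation \<alpha> (snd p) (fst p)) -` A \<inter> space ?P \<in> sets ?P"
    by measurable
  then have [measurable]: "(\<lambda>p. dilation \<alpha> (snd p) (fst p)) -` A \<in> sets ?P"
    by (simp add: space_pair_measure)
  have "emeasure (density lborel (\<lambda>x. ennreal (r x powr -Q))) A = (\<integral>\<^sup>+x. ennreal (r x powr -Q) * indicator A x \<partial>lborel)"
    by (rule emeasure_density) auto
  also have "\<dots> = (\<integral>\<^sup>+p. ennreal (polar_density r Q p) * indicator A (dilation \<alpha> (snd p) (fst p)) \<partial>(lborel \<Otimes>\<^sub>M lborel))"
    by (rule nn_integral_polar[OF _ r hom pos Q]) auto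
  also have "\<dots> = emeasure (distr (density (lborel \<Otimes>\<^sub>M lborel) (\<lambda>p. ennreal (polar_density r Q p))) borel
      (\<lambda>p. dilation \<alpha> (snd p) (fst p))) A"
    by (subst emeasure_distr, simp, simp, subst emeasure_density)
       (auto intro!: nn_integral_cong simp: space_pair_measure split: split_indicator)
  finally show "emeasure (density lborel (\<lambda>x. ennreal (r x powr -Q))) A = \<dots>" .
qed simp

text \<open>Equality of measures transports both integrability and the integral, so the polar formula passes
  from nonnegative to signed functions, and Fubini's theorem splits the integral over the pairs.\<close>

lemma integral_polar:
  fixes F :: "'a::euclidean_space \<times> 'b::euclidean_space \<Rightarrow> real" and r :: "'a \<times> 'b \<Rightarrow> real"
    and \<alpha> Q :: real
  assumes r[measurable]: "r \<in> borel_measurable borel"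
    and hom: "\<And>s x. 0 < s \<Longrightarrow> r (dilation \<alpha> s x) = s * r x"
    and pos: "AE x in lborel. 0 < r x"
    and Q: "Q = DIM('a) + (\<alpha> + 1) * DIM('b)" "0 < Q"
    and F[measurable]: "F \<in> borel_measurable borel"
    and int: "integrable lborel (\<lambda>x. r x powr -Q * F x)"
  shows "(\<integral>x. r x powr -Q * F x \<partial>lborel) =
    (\<integral>x. \<integral>s. polar_density r Q (x, s) * F (dilation \<alpha> s x) \<partial>lborel \<partial>lborel)"
proof -
  let ?D = "density (lborel \<Otimes>\<^sub>M lborel) (\<lambda>p. ennreal (polar_density r Q p)) :: (('a \<times> 'b) \<times> real) measure"
  let ?T = "\<lambda>p. dilation \<alpha> (snd p) (fst p)"
  have nn: "0 \<le> polar_density r Q p" for p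
    using \<open>0 < Q\<close> by (auto simp: polar_density_def split: prod.splits split_indicator)
  note eq = polar_measure[OF r hom pos Q]
  have "integrable (density lborel (\<lambda>x. ennreal (r x powr -Q))) F"
    using int by (subst integrable_density) auto
  then have "integrable (distr ?D borel ?T) F"
    by (subst (asm) eq)
  then have "integrable ?D (\<lambda>p. F (?T p))"
    by (subst (asm) integrable_distr_eq) auto
  then have int': "integrable (lborel \<Otimes>\<^sub>M lborel) (\<lambda>p. polar_density r Q p * F (?T p))"
    using nn by (subst (asm) integrable_density) auto
  have "(\<integral>x. r x powr -Q * F x \<partial>lborel) = integral\<^sup>L (density lborel (\<lambda>x. ennreal (r x powr -Q))) F"
    by (subst integral_density) auto
  also have "\<dots> = integral\<^sup>L (distr ?D borel ?T) F"
    by (rule arg_cong[OF eq])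
  also have "\<dots> = integral\<^sup>L ?D (\<lambda>p. F (?T p))"
    by (rule integral_distr) auto
  also have "\<dots> = (\<integral>p. polar_density r Q p * F (?T p) \<partial>(lborel \<Otimes>\<^sub>M lborel))"
    using nn by (subst integral_density) auto
  also have "\<dots> = (\<integral>x. \<integral>s. polar_density r Q (x, s) * F (dilation \<alpha> s x) \<partial>lborel \<partial>lborel)"
    using lborel_pair.integral_fst'[OF int'] by simp
  finally show ?thesis .
qed

section \<open>Derivatives of test functions\<close>

lemma test_function_has_derivative:
  assumes "test_function \<phi>"
  shows "(\<phi> has_derivative frechet_derivative \<phi> (at x)) (at x)"
proof -
  have "Ck_on (Suc 0) \<phi> UNIV" using assms unfolding test_function_def by blast
  then have "\<phi> differentiable (at x)" unfolding Ck_on.simps by blast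
  then show ?thesis by (rule frechet_derivative_works[THEN iffD1])
qed

text \<open>By linearity in the direction it suffices to treat fixed basis directions, for which continuity
  belongs to the definition of a test function.\<close>

lemma test_function_derivative_continuous:
  assumes "test_function \<phi>" "continuous_on S y" "continuous_on S v"
  shows "continuous_on S (\<lambda>t. frechet_derivative \<phi> (at (y t)) (v t))"
proof -
  have "Ck_on (Suc 0) \<phi> UNIV" using assms unfolding test_function_def by blast
  then have *: "continuous_on UNIV (\<lambda>x. frechet_derivative \<phi> (at x) b)" for b
    unfolding Ck_on.simps by blast
  have "frechet_derivative \<phi> (at (y t)) (v t) =
      (\<Sum>b\<in>Basis. (v t \<bullet> b) * frechet_derivative \<phi> (at (y t)) b)" for t
  proof -
    have lin: "linear (frechet_derivative \<phi> (at (y t)))"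
      using test_function_has_derivative[OF assms(1)] has_derivative_linear by blast
    have "frechet_derivative \<phi> (at (y t)) (v t) =
        frechet_derivative \<phi> (at (y t)) (\<Sum>b\<in>Basis. (v t \<bullet> b) *\<^sub>R b)"
      by (simp add: euclidean_representation)
    then show ?thesis unfolding linear_sum[OF lin] linear_scale[OF lin] real_scaleR_def .
  qed
  then have eq: "(\<lambda>t. frechet_derivative \<phi> (at (y t)) (v t)) =
      (\<lambda>t. \<Sum>b\<in>Basis. (v t \<bullet> b) * frechet_derivative \<phi> (at (y t)) b)"
    by (rule ext)
  show ?thesis
    by (subst eq) (intro continuous_on_sum continuous_on_mult continuous_on_inner continuous_on_const
      continuous_on_compose2[OF * assms(2)] assms(3) subset_UNIV)
qed

lemma test_function_derivative_zero:
  assumes "test_function \<phi>" "x \<notin> closure {x. \<phi> x \<noteq> 0}"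
  shows "\<phi> x = 0" "frechet_derivative \<phi> (at x) = (\<lambda>v. 0)"
proof -
  let ?K = "closure {x. \<phi> x \<noteq> 0}"
  have zero: "\<phi> y = 0" if "y \<in> - ?K" for y using that closure_subset[of "{x. \<phi> x \<noteq> 0}"] by auto
  have x: "x \<in> - ?K" using assms(2) by blast
  then show "\<phi> x = 0" by (rule zero)
  have "(\<phi> has_derivative (\<lambda>v. 0)) (at x)"
    by (rule has_derivative_transform_within_open[OF has_derivative_const[of 0] _ x])
       (rule open_Compl, rule closed_closure, rule zero[symmetric])
  then show "frechet_derivative \<phi> (at x) = (\<lambda>v. 0)"
    by (rule frechet_derivative_at[symmetric])
qed

text \<open>Each partial derivative is continuous and vanishes outside the compact support.\<close>

lemma test_function_derivative_bound:
  fixes \<phi> :: "'a::euclidean_space \<Rightarrow> real"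
  assumes "test_function \<phi>"
  obtains L where "0 < L" "\<And>x v. \<bar>frechet_derivative \<phi> (at x) v\<bar> \<le> L * norm v"
proof -
  let ?K = "closure {x. \<phi> x \<noteq> 0}"
  have K: "compact ?K" using assms by (simp add: test_function_def)
  have "\<exists>B. \<forall>x. \<bar>frechet_derivative \<phi> (at x) b\<bar> \<le> B" for b
  proof -
    have "compact ((\<lambda>x. frechet_derivative \<phi> (at x) b) ` ?K)"
      by (intro compact_continuous_image K test_function_derivative_continuous[OF assms] continuous_intros)
    from compact_imp_bounded[OF this] obtain B
      where "\<forall>y\<in>(\<lambda>x. frechet_derivative \<phi> (at x) b) ` ?K. norm y \<le> B"
      unfolding bounded_iff by blast
    then have B: "\<bar>frechet_derivative \<phi> (at x) b\<bar> \<le> B" if "x \<in> ?K" for x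
      using that by simp
    have "\<bar>frechet_derivative \<phi> (at x) b\<bar> \<le> max 0 B" for x
    proof (cases "x \<in> ?K")
      case True
      then show ?thesis using B[of x] by linarith
    next
      case False
      then show ?thesis unfolding test_function_derivative_zero(2)[OF assms False] by simp
    qed
    then show ?thesis by blast
  qed
  then obtain B where B: "\<And>b x. \<bar>frechet_derivative \<phi> (at x) b\<bar> \<le> B b" by metis
  have "\<bar>frechet_derivative \<phi> (at x) v\<bar> \<le> (1 + (\<Sum>b\<in>Basis. B b)) * norm v" for x v
  proof -
    have lin: "linear (frechet_derivative \<phi> (at x))"
      using test_function_has_derivative[OF assms(1)] has_derivative_linear by blast
    have "frechet_derivative \<phi> (at x) v = frechet_derivative \<phi> (at x) (\<Sum>b\<in>Basis. (v \<bullet> b) *\<^sub>R b)"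
      by (simp add: euclidean_representation)
    also have "\<dots> = (\<Sum>b\<in>Basis. (v \<bullet> b) * frechet_derivative \<phi> (at x) b)"
      unfolding linear_sum[OF lin] linear_scale[OF lin] real_scaleR_def ..
    also have "\<bar>\<dots>\<bar> \<le> (\<Sum>b\<in>Basis. norm v * B b)"
      by (intro order.trans[OF sum_abs] sum_mono)
         (auto simp: abs_mult intro!: mult_mono B Basis_le_norm)
    also have "\<dots> \<le> (1 + (\<Sum>b\<in>Basis. B b)) * norm v"
      unfolding sum_distrib_left[symmetric] distrib_right by simp
    finally show ?thesis .
  qed
  moreover have "0 \<le> (\<Sum>b\<in>Basis. B b)" by (intro sum_nonneg order.trans[OF abs_ge_zero B])
  ultimately show thesis by (intro that[of "1 + (\<Sum>b\<in>Basis. B b)"]) auto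
qed

section \<open>The gauge\<close>

text \<open>Strict convexity of \<open>\<Phi>\<^sup>2\<close> and \<open>\<Psi>\<^sup>2\<close> makes the dual norms, of which the gauge is composed,
  differentiable off the origin; the derivatives of \<open>\<Phi>\<close> and \<open>\<Psi>\<close> themselves occur in the flux.\<close>

locale grushin_gauge =
  fixes \<Phi> :: "'a::euclidean_space \<Rightarrow> real" and \<Psi> :: "'b::euclidean_space \<Rightarrow> real" and \<alpha> :: real
  assumes Phi: "minkowski_norm \<Phi>" and Psi: "minkowski_norm \<Psi>"
    and Phi_diff: "\<And>y. y \<noteq> 0 \<Longrightarrow> \<Phi> differentiable (at y)"
    and Psi_diff: "\<And>y. y \<noteq> 0 \<Longrightarrow> \<Psi> differentiable (at y)"
    and alpha_pos: "\<alpha> > 0"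
begin

abbreviation "\<rho> \<equiv> rho \<Phi> \<Psi> \<alpha>"

lemma rho_nonneg: "0 \<le> \<rho> x"
  by (simp add: rho_def)

lemma rho_powr:
  "\<rho> x powr (2 * (\<alpha> + 1)) =
    dual_norm \<Phi> (fst x) powr (2 * (\<alpha> + 1)) + 4 * (\<alpha> + 1)\<^sup>2 * (dual_norm \<Psi> (snd x))\<^sup>2"
  using alpha_pos by (simp add: rho_def powr_powr)

lemma rho_pos: "x \<noteq> 0 \<Longrightarrow> 0 < \<rho> x"
proof -
  assume "x \<noteq> 0"
  then have "fst x \<noteq> 0 \<or> snd x \<noteq> 0" by (simp add: prod_eq_iff)
  then have "0 < dual_norm \<Phi> (fst x) powr (2 * (\<alpha> + 1)) + 4 * (\<alpha> + 1)\<^sup>2 * (dual_norm \<Psi> (snd x))\<^sup>2"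
    using dual_norm_pos[OF Phi, of "fst x"] dual_norm_pos[OF Psi, of "snd x"] alpha_pos
    by (auto intro: add_pos_nonneg add_nonneg_pos)
  then show ?thesis by (simp add: rho_def)
qed

lemma rho_dilation:
  assumes "0 < s"
  shows "\<rho> (dilation \<alpha> s x) = s * \<rho> x"
proof -
  have "s powr (2 * (\<alpha> + 1)) = (s powr (\<alpha> + 1))\<^sup>2"
    using assms by (simp add: power2_eq_square powr_add[symmetric])
  then have "\<rho> (dilation \<alpha> s x) = (s powr (2 * (\<alpha> + 1)) * (dual_norm \<Phi> (fst x) powr (2 * (\<alpha> + 1)) +
      4 * (\<alpha> + 1)\<^sup>2 * (dual_norm \<Psi> (snd x))\<^sup>2)) powr (1 / (2 * (\<alpha> + 1)))"
    using assms dual_norm_nonneg[OF Phi, of "fst x"]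
    by (simp add: rho_def dilation_def dual_norm_scale[OF Phi] dual_norm_scale[OF Psi] powr_mult
        power_mult_distrib distrib_left mult.left_commute)
  also have "\<dots> = s * \<rho> x"
    using assms alpha_pos by (subst powr_mult) (auto simp: rho_def powr_powr)
  finally show ?thesis .
qed

lemma dual_norm_fst_le_rho: "dual_norm \<Phi> (fst x) \<le> \<rho> x"
proof (rule ccontr)
  assume "\<not> ?thesis"
  then have "\<rho> x powr (2 * (\<alpha> + 1)) < dual_norm \<Phi> (fst x) powr (2 * (\<alpha> + 1))"
    using alpha_pos rho_nonneg[of x] by (intro powr_less_mono2) auto
  moreover have "0 \<le> 4 * (\<alpha> + 1)\<^sup>2 * (dual_norm \<Psi> (snd x))\<^sup>2" by simp
  ultimately show False unfolding rho_powr by linarith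
qed

lemma dual_norm_snd_le_rho: "dual_norm \<Psi> (snd x) \<le> \<rho> x powr (\<alpha> + 1)"
proof -
  have "1 \<le> (\<alpha> + 1)\<^sup>2" using alpha_pos by simp
  then have "(dual_norm \<Psi> (snd x))\<^sup>2 \<le> 4 * (\<alpha> + 1)\<^sup>2 * (dual_norm \<Psi> (snd x))\<^sup>2"
    by (intro mult_le_cancel_right1[THEN iffD2]) auto
  also have "\<dots> \<le> \<rho> x powr (2 * (\<alpha> + 1))" unfolding rho_powr by simp
  also have "\<dots> = (\<rho> x powr (\<alpha> + 1))\<^sup>2" by (simp add: power2_eq_square powr_add[symmetric])
  finally show ?thesis by (rule power2_le_imp_le) simp
qed

lemma norm_le_rho:
  obtains C where "0 < C" "\<And>x. norm (fst x) \<le> C * \<rho> x" "\<And>x. norm (snd x) \<le> C * \<rho> x powr (\<alpha> + 1)"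
proof -
  obtain A where A: "0 < A" "\<And>x. norm x \<le> A * dual_norm \<Phi> x" using norm_le_dual_norm[OF Phi] by metis
  obtain B where B: "0 < B" "\<And>x. norm x \<le> B * dual_norm \<Psi> x" using norm_le_dual_norm[OF Psi] by metis
  show thesis
  proof (rule that)
    show "0 < max A B" using A by simp
    show "norm (fst x) \<le> max A B * \<rho> x" for x
      using A(2)[of "fst x"] A(1)
        mult_mono[of A "max A B" "dual_norm \<Phi> (fst x)" "\<rho> x"] dual_norm_fst_le_rho[of x]
        dual_norm_nonneg[OF Phi, of "fst x"]
      by fastforce
    show "norm (snd x) \<le> max A B * \<rho> x powr (\<alpha> + 1)" for x
      using B(2)[of "snd x"] B(1)
        mult_mono[of B "max A B" "dual_norm \<Psi> (snd x)" "\<rho> x powr (\<alpha> + 1)"] dual_norm_snd_le_rho[of x]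
        dual_norm_nonneg[OF Psi, of "snd x"]
      by fastforce
  qed
qed

lemma dual_norm_fst_continuous: "continuous_on UNIV (\<lambda>x. dual_norm \<Phi> (fst x))"
  by (rule continuous_on_compose2[OF dual_norm_continuous[OF Phi]]) (auto intro: continuous_intros)

lemma rho_continuous: "continuous_on UNIV \<rho>"
proof -
  have 1: "continuous_on UNIV (\<lambda>x::'a\<times>'b. dual_norm \<Psi> (snd x))"
    by (rule continuous_on_compose2[OF dual_norm_continuous[OF Psi]]) (auto intro: continuous_intros)
  show ?thesis
    unfolding rho_def[abs_def] using alpha_pos
    by (intro continuous_on_powr' continuous_intros dual_norm_fst_continuous 1)
       (auto simp: dual_norm_nonneg[OF Phi] add_nonneg_nonneg)
qed

section \<open>The flux of a function of the gauge\<close>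

lemma rho_GDERIV_fst:
  assumes "fst x \<noteq> 0" and \<xi>: "\<Phi> \<xi> = 1" "fst x \<bullet> \<xi> = dual_norm \<Phi> (fst x)"
  shows "GDERIV (\<lambda>z. \<rho> (z, snd x)) (fst x) :>
    (dual_norm \<Phi> (fst x) powr (2 * \<alpha> + 1) * \<rho> x powr - (2 * \<alpha> + 1)) *\<^sub>R \<xi>"
proof -
  define N where "N = 2 * (\<alpha> + 1)"
  have N: "N > 0" using alpha_pos by (simp add: N_def)
  have e: "N - 1 = 2 * \<alpha> + 1" "1 - N = - (2 * \<alpha> + 1)" "2 * N = 4 * (\<alpha> + 1)"
    by (simp_all add: N_def)
  let ?a = "dual_norm \<Phi> (fst x)"
  define K where "K = 4 * (\<alpha> + 1)\<^sup>2 * (dual_norm \<Psi> (snd x))\<^sup>2"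
  have a: "?a > 0" by (rule dual_norm_pos[OF Phi assms(1)])
  have S: "?a powr N + K > 0" using a by (auto simp: K_def intro: add_pos_nonneg)
  have rho: "\<rho> x = (?a powr N + K) powr (1 / N)" by (simp add: rho_def N_def K_def)
  have r: "\<rho> x > 0" using assms(1) by (intro rho_pos) auto
  have "((\<lambda>t. (t powr N + K) powr (1 / N)) has_real_derivative
      (1 / N) * (?a powr N + K) powr (1 / N - 1) * (N * ?a powr (N - 1))) (at ?a)"
    using a S N by (auto intro!: derivative_eq_intros)
  also have "(1 / N) * (?a powr N + K) powr (1 / N - 1) * (N * ?a powr (N - 1)) =
      ?a powr (N - 1) * (?a powr N + K) powr ((1 / N) * (1 - N))"
    using N by (simp add: field_simps)
  also have "(?a powr N + K) powr ((1 / N) * (1 - N)) = \<rho> x powr (1 - N)"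
    unfolding rho by (simp add: powr_powr)
  finally have "((\<lambda>t. (t powr N + K) powr (1 / N)) has_real_derivative
      ?a powr (2 * \<alpha> + 1) * \<rho> x powr - (2 * \<alpha> + 1)) (at ?a)"
    unfolding e .
  from GDERIV_DERIV_compose[OF dual_norm_GDERIV[OF Phi assms] this]
  show ?thesis by (simp add: rho_def N_def K_def)
qed

lemma rho_GDERIV_snd:
  assumes "snd x \<noteq> 0" and \<eta>: "\<Psi> \<eta> = 1" "snd x \<bullet> \<eta> = dual_norm \<Psi> (snd x)"
  shows "GDERIV (\<lambda>\<sigma>. \<rho> (fst x, \<sigma>)) (snd x) :>
    (4 * (\<alpha> + 1) * dual_norm \<Psi> (snd x) * \<rho> x powr - (2 * \<alpha> + 1)) *\<^sub>R \<eta>"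
proof -
  define N where "N = 2 * (\<alpha> + 1)"
  have N: "N > 0" using alpha_pos by (simp add: N_def)
  have e: "N - 1 = 2 * \<alpha> + 1" "1 - N = - (2 * \<alpha> + 1)" "2 * N = 4 * (\<alpha> + 1)"
    by (simp_all add: N_def)
  let ?b = "dual_norm \<Psi> (snd x)"
  define K where "K = dual_norm \<Phi> (fst x) powr N"
  have b: "?b > 0" by (rule dual_norm_pos[OF Psi assms(1)])
  have S: "K + N\<^sup>2 * ?b\<^sup>2 > 0" using b N by (auto simp: K_def intro!: add_nonneg_pos)
  have N2: "4 * (\<alpha> + 1)\<^sup>2 = N\<^sup>2" by (simp only: N_def power_mult_distrib) simp
  have rho: "\<rho> x = (K + N\<^sup>2 * ?b\<^sup>2) powr (1 / N)" unfolding rho_def N2 by (simp add: N_def K_def)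
  have "((\<lambda>t. (K + N\<^sup>2 * t\<^sup>2) powr (1 / N)) has_real_derivative
      (1 / N) * (K + N\<^sup>2 * ?b\<^sup>2) powr (1 / N - 1) * (N\<^sup>2 * (2 * ?b))) (at ?b)"
    using S N by (auto intro!: derivative_eq_intros)
  also have "(1 / N) * (K + N\<^sup>2 * ?b\<^sup>2) powr (1 / N - 1) * (N\<^sup>2 * (2 * ?b)) =
      2 * N * ?b * (K + N\<^sup>2 * ?b\<^sup>2) powr ((1 / N) * (1 - N))"
    using N by (simp add: field_simps power2_eq_square)
  also have "(K + N\<^sup>2 * ?b\<^sup>2) powr ((1 / N) * (1 - N)) = \<rho> x powr (1 - N)"
    unfolding rho by (simp add: powr_powr)
  finally have "((\<lambda>t. (K + N\<^sup>2 * t\<^sup>2) powr (1 / N)) has_real_derivative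
      4 * (\<alpha> + 1) * ?b * \<rho> x powr - (2 * \<alpha> + 1)) (at ?b)"
    unfolding e .
  from GDERIV_DERIV_compose[OF dual_norm_GDERIV[OF Psi assms] this]
  show ?thesis unfolding rho_def N2 by (simp add: N_def K_def)
qed

text \<open>Write \<open>a\<close> and \<open>b\<close> for the two dual norms at \<open>x\<close>. The partial gradients of \<open>\<rho>\<close> are multiples of the
  maximisers \<open>\<xi>\<close> and \<open>\<eta>\<close>, at which \<open>\<Phi>\<close> and \<open>\<Psi>\<close> equal \<open>1\<close>. Hence the energy density of \<open>g \<circ> \<rho>\<close> is
  \<open>d\<^sup>2\<close> times \<open>\<rho> powr -(4 * \<alpha> + 2) * a powr (2 * \<alpha>) * (a powr (2 * \<alpha> + 2) + 4 * (\<alpha> + 1)\<^sup>2 * b\<^sup>2)\<close>; the last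
  factor is \<open>\<rho> powr (2 * \<alpha> + 2)\<close>, so the product collapses to \<open>(a / \<rho>) powr (2 * \<alpha>)\<close>.
  In \<open>A_field\<close> the gradients of \<open>\<Phi>\<close> and \<open>\<Psi>\<close> at these multiples point along \<open>fst x\<close> and \<open>snd x\<close>,
  and the result is parallel to the generator of the dilations.\<close>

lemma flux_radial:
  assumes x: "fst x \<noteq> 0" "snd x \<noteq> 0" and g: "(g has_real_derivative d) (at (\<rho> x))"
  shows "flux \<Phi> \<Psi> \<alpha> p (\<lambda>y. g (\<rho> y)) x =
    (\<bar>d\<bar> powr (p - 2) * d * (dual_norm \<Phi> (fst x) / \<rho> x) powr (\<alpha> * p) / \<rho> x) *\<^sub>R
      (fst x, (\<alpha> + 1) *\<^sub>R snd x)"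
proof -
  let ?u = "\<lambda>y. g (\<rho> y)"
  let ?a = "dual_norm \<Phi> (fst x)" and ?b = "dual_norm \<Psi> (snd x)"
  obtain \<xi> where \<xi>: "\<Phi> \<xi> = 1" "fst x \<bullet> \<xi> = ?a" using dual_norm_attained[OF Phi] by metis
  obtain \<eta> where \<eta>: "\<Psi> \<eta> = 1" "snd x \<bullet> \<eta> = ?b" using dual_norm_attained[OF Psi] by metis
  \<comment> \<open>the coefficients of \<open>\<xi>\<close> and \<open>\<eta>\<close> in the two partial gradients of \<open>g \<circ> \<rho>\<close>\<close>
  define c1 where "c1 = d * (?a powr (2 * \<alpha> + 1) * \<rho> x powr - (2 * \<alpha> + 1))"
  define c2 where "c2 = d * (4 * (\<alpha> + 1) * ?b * \<rho> x powr - (2 * \<alpha> + 1))"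
  have a: "?a > 0" by (rule dual_norm_pos[OF Phi x(1)])
  have b: "?b > 0" by (rule dual_norm_pos[OF Psi x(2)])
  have r: "\<rho> x > 0" using x(1) by (intro rho_pos) auto
  have g1: "grad_fst ?u x = c1 *\<^sub>R \<xi>"
    using GDERIV_DERIV_compose[OF rho_GDERIV_fst[OF x(1) \<xi>], of g d] g
    unfolding grad_fst_def c1_def by (intro grad_eqI) simp
  have g2: "grad_snd ?u x = c2 *\<^sub>R \<eta>"
    using GDERIV_DERIV_compose[OF rho_GDERIV_snd[OF x(2) \<eta>], of g d] g
    unfolding grad_snd_def c2_def by (intro grad_eqI) simp
  have "energy_density \<Phi> \<Psi> \<alpha> ?u x = c1\<^sup>2 + ?a powr (2 * \<alpha>) / 4 * c2\<^sup>2"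
    unfolding energy_density_def g1 g2
    by (simp add: minkowski_scale[OF Phi] minkowski_scale[OF Psi] \<xi> \<eta>)
  also have "\<dots> = d\<^sup>2 * (\<rho> x powr - (2 * \<alpha> + 1))\<^sup>2 * ?a powr (2 * \<alpha>) *
      (?a powr (2 * (\<alpha> + 1)) + 4 * (\<alpha> + 1)\<^sup>2 * ?b\<^sup>2)"
  proof -
    have "(?a powr (2 * \<alpha> + 1))\<^sup>2 = ?a powr (2 * \<alpha>) * ?a powr (2 * (\<alpha> + 1))"
      by (simp add: power2_eq_square powr_add[symmetric])
    then have "c1\<^sup>2 = d\<^sup>2 * (?a powr (2 * \<alpha>) * ?a powr (2 * (\<alpha> + 1)) * (\<rho> x powr - (2 * \<alpha> + 1))\<^sup>2)"
      by (simp only: c1_def power_mult_distrib)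
    moreover have "c2\<^sup>2 = d\<^sup>2 * (4\<^sup>2 * (\<alpha> + 1)\<^sup>2 * ?b\<^sup>2 * (\<rho> x powr - (2 * \<alpha> + 1))\<^sup>2)"
      by (simp only: c2_def power_mult_distrib)
    ultimately show ?thesis by (simp add: algebra_simps)
  qed
  also have "\<dots> = d\<^sup>2 * ((\<rho> x powr - (2 * \<alpha> + 1))\<^sup>2 * \<rho> x powr (2 * (\<alpha> + 1))) * ?a powr (2 * \<alpha>)"
    unfolding rho_powr by (simp only: ac_simps)
  also have "(\<rho> x powr - (2 * \<alpha> + 1))\<^sup>2 * \<rho> x powr (2 * (\<alpha> + 1)) = \<rho> x powr - (2 * \<alpha>)"
    by (simp add: power2_eq_square powr_add[symmetric])
  also have "d\<^sup>2 * \<rho> x powr - (2 * \<alpha>) * ?a powr (2 * \<alpha>) = \<bar>d\<bar>\<^sup>2 * (?a / \<rho> x) powr (2 * \<alpha>)"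
    using a r by (simp add: powr_divide powr_minus field_simps)
  finally have E0: "energy_density \<Phi> \<Psi> \<alpha> ?u x = \<bar>d\<bar>\<^sup>2 * (?a / \<rho> x) powr (2 * \<alpha>)" .
  have "(\<bar>d\<bar>\<^sup>2) powr ((p - 2) / 2) = \<bar>d\<bar> powr (p - 2)"
  proof (cases "d = 0")
    case False
    then have "(\<bar>d\<bar>\<^sup>2) powr ((p - 2) / 2) = (\<bar>d\<bar> powr 2) powr ((p - 2) / 2)" by simp
    also have "\<dots> = \<bar>d\<bar> powr (2 * ((p - 2) / 2))" by (rule powr_powr)
    also have "2 * ((p - 2) / 2) = p - 2" by simp
    finally show ?thesis .
  qed simp
  moreover have "((?a / \<rho> x) powr (2 * \<alpha>)) powr ((p - 2) / 2) = (?a / \<rho> x) powr (\<alpha> * (p - 2))"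
    unfolding powr_powr by simp
  ultimately have E: "energy_density \<Phi> \<Psi> \<alpha> ?u x powr ((p - 2) / 2) =
      \<bar>d\<bar> powr (p - 2) * (?a / \<rho> x) powr (\<alpha> * (p - 2))"
    unfolding E0 by (subst powr_mult) simp_all
  have A: "A_field \<Phi> \<Psi> \<alpha> ?u x = (d * (?a / \<rho> x) powr (2 * \<alpha>) / \<rho> x) *\<^sub>R (fst x, (\<alpha> + 1) *\<^sub>R snd x)"
  proof -
    have 0: "\<rho> x powr - (2 * \<alpha> + 1) = \<rho> x powr - (2 * \<alpha>) / \<rho> x"
      using r by (simp add: powr_diff powr_minus field_simps powr_add)
    have "c1 / ?a = d * (?a / \<rho> x) powr (2 * \<alpha>) / \<rho> x"
      using a r unfolding c1_def 0 by (simp add: powr_add powr_divide powr_minus field_simps)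
    then have 1: "\<Phi> (c1 *\<^sub>R \<xi>) *\<^sub>R grad \<Phi> (c1 *\<^sub>R \<xi>) = (d * (?a / \<rho> x) powr (2 * \<alpha>) / \<rho> x) *\<^sub>R fst x"
      using minkowski_grad_at_maximiser[OF Phi _ x(1) \<xi>, of c1] Phi_diff by metis
    have "c2 / ?b = 4 * d * \<rho> x powr - (2 * \<alpha>) / \<rho> x * (\<alpha> + 1)"
      using b r unfolding c2_def 0 by (simp add: field_simps)
    then have 2: "\<Psi> (c2 *\<^sub>R \<eta>) *\<^sub>R grad \<Psi> (c2 *\<^sub>R \<eta>) = (4 * d * \<rho> x powr - (2 * \<alpha>) / \<rho> x * (\<alpha> + 1)) *\<^sub>R snd x"
      using minkowski_grad_at_maximiser[OF Psi _ x(2) \<eta>, of c2] Psi_diff by metis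
    have "(?a powr (2 * \<alpha>) / 4 * \<Psi> (c2 *\<^sub>R \<eta>)) *\<^sub>R grad \<Psi> (c2 *\<^sub>R \<eta>) =
        (?a powr (2 * \<alpha>) / 4) *\<^sub>R (4 * d * \<rho> x powr - (2 * \<alpha>) / \<rho> x * (\<alpha> + 1)) *\<^sub>R snd x"
      unfolding 2[symmetric] by simp
    also have "\<dots> = (d * (?a / \<rho> x) powr (2 * \<alpha>) / \<rho> x) *\<^sub>R (\<alpha> + 1) *\<^sub>R snd x"
      unfolding scaleR_scaleR using a r
      by (intro arg_cong2[of _ _ _ _ scaleR] refl) (simp add: powr_divide powr_minus field_simps)
    finally show ?thesis unfolding A_field_def g1 g2 1 by simp
  qed
  have "(?a / \<rho> x) powr (\<alpha> * p) = (?a / \<rho> x) powr (\<alpha> * (p - 2)) * (?a / \<rho> x) powr (2 * \<alpha>)"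
    by (simp add: powr_add[symmetric] algebra_simps)
  then have "\<bar>d\<bar> powr (p - 2) * (?a / \<rho> x) powr (\<alpha> * (p - 2)) * (d * (?a / \<rho> x) powr (2 * \<alpha>) / \<rho> x)
      = \<bar>d\<bar> powr (p - 2) * d * (?a / \<rho> x) powr (\<alpha> * p) / \<rho> x"
    by (simp add: ac_simps)
  then show ?thesis unfolding flux_def E A scaleR_scaleR by (rule arg_cong)
qed

section \<open>Homogeneity and integrability\<close>

definition homogeneous_dim :: real where
  "homogeneous_dim = DIM('a) + (\<alpha> + 1) * DIM('b)"

text \<open>The \<open>p\<close>-th power of the length of the gradient of \<open>\<rho>\<close>, measured by the energy density. It is
  constant along the orbits of the dilations.\<close>

definition angular :: "real \<Rightarrow> 'a \<times> 'b \<Rightarrow> real" where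
  "angular p x = (dual_norm \<Phi> (fst x) / \<rho> x) powr (\<alpha> * p)"

text \<open>The infinitesimal generator of the dilations.\<close>

definition euler_field :: "'a \<times> 'b \<Rightarrow> 'a \<times> 'b" where
  "euler_field x = (fst x, (\<alpha> + 1) *\<^sub>R snd x)"

lemma homogeneous_dim_pos: "0 < homogeneous_dim"
  using alpha_pos by (auto simp: homogeneous_dim_def intro!: add_pos_nonneg)

lemma AE_rho_pos: "AE x in lborel. 0 < \<rho> x"
  using AE_lborel_singleton[of 0] by eventually_elim (rule rho_pos)

lemma rho_measurable [measurable]: "\<rho> \<in> borel_measurable borel"
  by (rule borel_measurable_continuous_onI[OF rho_continuous])

lemma angular_measurable [measurable]: "angular p \<in> borel_measurable borel"
proof -
  have [measurable]: "(\<lambda>x::'a\<times>'b. dual_norm \<Phi> (fst x)) \<in> borel_measurable borel"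
    by (rule borel_measurable_continuous_onI[OF dual_norm_fst_continuous])
  show ?thesis unfolding angular_def[abs_def] by measurable
qed

lemma angular_nonneg: "0 \<le> angular p x"
  by (simp add: angular_def)

lemma angular_le_1:
  assumes "0 \<le> p"
  shows "angular p x \<le> 1"
proof (cases "\<rho> x = 0")
  case False
  then have "\<rho> x > 0" using rho_nonneg[of x] by linarith
  then have "dual_norm \<Phi> (fst x) / \<rho> x \<le> 1" using dual_norm_fst_le_rho[of x] by simp
  then show ?thesis
    unfolding angular_def using assms alpha_pos dual_norm_nonneg[OF Phi, of "fst x"] rho_nonneg[of x]
    by (intro powr_le1) auto
qed (simp add: angular_def)

lemma angular_dilation:
  assumes "0 < s"
  shows "angular p (dilation \<alpha> s x) = angular p x"
  using assms unfolding angular_def rho_dilation[OF assms]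
  by (simp add: dilation_def dual_norm_scale[OF Phi])

lemma euler_field_measurable [measurable]: "euler_field \<in> borel_measurable borel"
  unfolding euler_field_def[abs_def]
  by (intro borel_measurable_continuous_onI continuous_intros)

text \<open>The second component grows like \<open>\<rho> powr (\<alpha> + 1)\<close>, so a linear bound in \<open>\<rho>\<close> holds only on balls.\<close>

lemma norm_euler_field_le:
  obtains L where "0 < L" "\<And>x. \<rho> x < R \<Longrightarrow> norm (euler_field x) \<le> L * \<rho> x"
proof -
  obtain C where C: "0 < C" "\<And>x. norm (fst x) \<le> C * \<rho> x" "\<And>x. norm (snd x) \<le> C * \<rho> x powr (\<alpha> + 1)"
    using norm_le_rho by metis
  show thesis
  proof (rule that)
    show "0 < C + (\<alpha> + 1) * (C * \<bar>R\<bar> powr \<alpha>)" using C(1) alpha_pos by (simp add: add_pos_nonneg)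
    fix x assume R: "\<rho> x < R"
    have "norm (euler_field x) \<le> norm (fst x) + norm ((\<alpha> + 1) *\<^sub>R snd x)"
      unfolding euler_field_def by (rule norm_Pair_le)
    also have "\<dots> = norm (fst x) + (\<alpha> + 1) * norm (snd x)" using alpha_pos by simp
    also have "\<dots> \<le> C * \<rho> x + (\<alpha> + 1) * (C * \<rho> x powr (\<alpha> + 1))"
      using C alpha_pos by (intro add_mono mult_left_mono) auto
    also have "\<rho> x powr (\<alpha> + 1) = \<rho> x powr \<alpha> * \<rho> x"
      using rho_nonneg[of x] by (simp add: powr_add)
    also have "C * \<rho> x + (\<alpha> + 1) * (C * (\<rho> x powr \<alpha> * \<rho> x)) \<le> C * \<rho> x + (\<alpha> + 1) * (C * (\<bar>R\<bar> powr \<alpha> * \<rho> x))"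
      using C alpha_pos R rho_nonneg[of x]
      by (intro add_left_mono mult_left_mono mult_right_mono powr_mono2) auto
    also have "\<dots> = (C + (\<alpha> + 1) * (C * \<bar>R\<bar> powr \<alpha>)) * \<rho> x" by (simp add: algebra_simps)
    finally show "norm (euler_field x) \<le> (C + (\<alpha> + 1) * (C * \<bar>R\<bar> powr \<alpha>)) * \<rho> x" .
  qed
qed

lemma emeasure_rho_ball_finite: "emeasure lborel {x. \<rho> x < 1} < \<infinity>"
proof (rule emeasure_bounded_finite)
  obtain L where L: "0 < L" "\<And>x. \<rho> x < 1 \<Longrightarrow> norm (euler_field x) \<le> L * \<rho> x"
    using norm_euler_field_le by metis
  have "norm x \<le> L" if "\<rho> x < 1" for x
  proof -
    have "(norm x)\<^sup>2 = (norm (fst x))\<^sup>2 + (norm (snd x))\<^sup>2" by (cases x) (simp add: norm_Pair)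
    also have "\<dots> \<le> (norm (fst x))\<^sup>2 + (norm ((\<alpha> + 1) *\<^sub>R snd x))\<^sup>2"
      using alpha_pos by (intro add_left_mono power_mono) (auto simp: mult_le_cancel_right1)
    also have "\<dots> = (norm (euler_field x))\<^sup>2" by (simp add: euler_field_def norm_Pair)
    finally have "norm x \<le> norm (euler_field x)" by (rule power2_le_imp_le) simp
    also have "\<dots> \<le> L * \<rho> x" by (rule L(2)[OF that])
    also have "\<dots> \<le> L" using L(1) that by simp
    finally show ?thesis .
  qed
  then show "bounded {x. \<rho> x < 1}" unfolding bounded_iff by blast
qed

text \<open>In polar coordinates the integrand is at most \<open>Q / s * K * s * \<rho> x\<close>, so the factor \<open>s\<close> cancels, and it
  lives on the scales \<open>s < R / \<rho> x\<close>. The integral over \<open>s\<close> is thus bounded by \<open>Q * K * R\<close>, and what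
  remains is the finite volume of the unit ball.\<close>

lemma integrable_rho_powr:
  fixes F :: "'a \<times> 'b \<Rightarrow> 'c::{banach, second_countable_topology}"
  assumes F[measurable]: "F \<in> borel_measurable borel"
    and K: "\<And>x. norm (F x) \<le> K * \<rho> x" and R: "\<And>x. R \<le> \<rho> x \<Longrightarrow> F x = 0" and "0 \<le> K" "0 < R"
  shows "integrable lborel (\<lambda>x. \<rho> x powr -homogeneous_dim *\<^sub>R F x)"
proof (rule integrableI_bounded)
  let ?Q = homogeneous_dim
  let ?B = "ennreal (?Q * K * R)"
  have "(\<integral>\<^sup>+x. ennreal (norm (\<rho> x powr -?Q *\<^sub>R F x)) \<partial>lborel)
      = (\<integral>\<^sup>+x. ennreal (\<rho> x powr -?Q) * ennreal (norm (F x)) \<partial>lborel)"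
    by (simp add: ennreal_mult)
  also have "\<dots> = (\<integral>\<^sup>+p. ennreal (polar_density \<rho> ?Q p) * ennreal (norm (F (dilation \<alpha> (snd p) (fst p))))
      \<partial>(lborel \<Otimes>\<^sub>M lborel))"
    by (rule nn_integral_polar[OF _ rho_measurable rho_dilation AE_rho_pos homogeneous_dim_def homogeneous_dim_pos]) auto
  also have "\<dots> = (\<integral>\<^sup>+x. \<integral>\<^sup>+s. ennreal (polar_density \<rho> ?Q (x, s)) * ennreal (norm (F (dilation \<alpha> s x)))
      \<partial>lborel \<partial>lborel)"
    by (subst lborel.nn_integral_fst[symmetric]) auto
  also have "\<dots> \<le> (\<integral>\<^sup>+x. ?B * indicator {x. \<rho> x < 1} x \<partial>lborel)"
  proof (rule nn_integral_mono_AE, use AE_rho_pos in eventually_elim)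
    fix x assume x: "0 < \<rho> x"
    have "(\<integral>\<^sup>+s. ennreal (polar_density \<rho> ?Q (x, s)) * ennreal (norm (F (dilation \<alpha> s x))) \<partial>lborel)
        \<le> (\<integral>\<^sup>+s. ennreal (?Q * K * \<rho> x) * indicator {x. \<rho> x < 1} x * indicator {0..R / \<rho> x} s \<partial>lborel)"
    proof (rule nn_integral_mono)
      fix s :: real
      show "ennreal (polar_density \<rho> ?Q (x, s)) * ennreal (norm (F (dilation \<alpha> s x)))
        \<le> ennreal (?Q * K * \<rho> x) * indicator {x. \<rho> x < 1} x * indicator {0..R / \<rho> x} s"
      proof (cases "\<rho> x < 1 \<and> 0 < s \<and> s < R / \<rho> x")
        case True
        then have s: "0 < s" by simp
        have "norm (F (dilation \<alpha> s x)) \<le> K * (s * \<rho> x)"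
          using K[of "dilation \<alpha> s x"] unfolding rho_dilation[OF s] .
        moreover have "polar_density \<rho> ?Q (x, s) = ?Q / s" using True by (simp add: polar_density_def)
        ultimately have "polar_density \<rho> ?Q (x, s) * norm (F (dilation \<alpha> s x)) \<le> ?Q / s * (K * (s * \<rho> x))"
          using s homogeneous_dim_pos by (simp only:) (intro mult_left_mono, auto)
        also have "\<dots> = ?Q * K * \<rho> x" using s by simp
        finally show ?thesis
          using True homogeneous_dim_pos
          by (subst ennreal_mult'[symmetric]) (auto simp: polar_density_def intro!: ennreal_leI)
      next
        case False
        then consider "\<not> \<rho> x < 1" | "s \<le> 0" | "0 < s" "R / \<rho> x \<le> s" by linarith
        then have "polar_density \<rho> ?Q (x, s) = 0 \<or> F (dilation \<alpha> s x) = 0"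
        proof cases
          case 3
          then have "R \<le> \<rho> (dilation \<alpha> s x)" using x by (simp add: rho_dilation field_simps)
          then show ?thesis using R by simp
        qed (simp_all add: polar_density_def)
        then show ?thesis by auto
      qed
    qed
    also have "\<dots> = ennreal (?Q * K * \<rho> x) * indicator {x. \<rho> x < 1} x * ennreal (R / \<rho> x)"
      using x \<open>0 < R\<close> by (simp add: nn_integral_cmult)
    also have "\<dots> = ?B * indicator {x. \<rho> x < 1} x"
      using x \<open>0 < R\<close> \<open>0 \<le> K\<close> homogeneous_dim_pos
      by (auto simp: ennreal_mult[symmetric] split: split_indicator)
    finally show "(\<integral>\<^sup>+s. ennreal (polar_density \<rho> ?Q (x, s)) * ennreal (norm (F (dilation \<alpha> s x))) \<partial>lborel)
        \<le> ?B * indicator {x. \<rho> x < 1} x" .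
  qed
  also have "\<dots> = ?B * emeasure lborel {x. \<rho> x < 1}"
    by (subst nn_integral_cmult) auto
  also have "\<dots> < \<infinity>" using emeasure_rho_ball_finite by (simp add: ennreal_mult_less_top)
  finally show "(\<integral>\<^sup>+x. ennreal (norm (\<rho> x powr -?Q *\<^sub>R F x)) \<partial>lborel) < \<infinity>" .
qed measurable

section \<open>The angular mass\<close>

text \<open>Off this null set the dual norms of both components, hence \<open>\<rho>\<close>, are differentiable, and the
  angular factor is positive.\<close>

definition coordinate_planes :: "('a \<times> 'b) set" where
  "coordinate_planes = {x. fst x = 0 \<or> snd x = 0}"

lemma negligible_coordinate_planes: "negligible coordinate_planes"
proof -
  obtain u :: 'a where u: "u \<in> Basis" using nonempty_Basis by blast
  obtain v :: 'b where v: "v \<in> Basis" using nonempty_Basis by blast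
  have "negligible {x. (u, 0::'b) \<bullet> x = 0}" "negligible {x. (0::'a, v) \<bullet> x = 0}"
    using u v by (intro negligible_hyperplane; auto simp: zero_prod_def)+
  then have "negligible ({x. (u, 0::'b) \<bullet> x = 0} \<union> {x. (0::'a, v) \<bullet> x = 0})"
    by (rule negligible_Un)
  then show ?thesis
    by (rule negligible_subset) (auto simp: coordinate_planes_def inner_prod_def)
qed

lemma AE_coordinate_planes: "AE x in lebesgue. x \<notin> coordinate_planes"
  using negligible_coordinate_planes by (simp add: negligible_iff_null_sets AE_not_in)

definition angular_mass :: "real \<Rightarrow> real" where
  "angular_mass p = (LINT x:{x. \<rho> x < 1}|lebesgue. angular p x)"

lemma angular_mass_eq: "angular_mass p = (\<integral>x. indicator {x. \<rho> x < 1} x * angular p x \<partial>lborel)"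
  unfolding angular_mass_def set_lebesgue_integral_def by (subst integral_completion) auto

text \<open>If the integral vanished, the angular factor would be zero almost everywhere on the unit ball,
  although it is positive off a null set and the unit ball is open and nonempty.\<close>

lemma angular_mass_pos:
  assumes "0 \<le> p"
  shows "0 < angular_mass p"
proof -
  let ?f = "\<lambda>x. indicator {x. \<rho> x < 1} x * angular p x"
  have int: "integrable lborel ?f"
  proof (rule Bochner_Integration.integrable_bound)
    show "integrable lborel (indicator {x. \<rho> x < 1} :: 'a \<times> 'b \<Rightarrow> real)"
      using emeasure_rho_ball_finite by (intro integrable_real_indicator) auto
  qed (use angular_nonneg[of p] angular_le_1[OF assms] in \<open>auto split: split_indicator\<close>)
  have nonneg: "0 \<le> ?f x" for x using angular_nonneg by simp
  have "angular_mass p \<noteq> 0"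
  proof
    assume "angular_mass p = 0"
    then have "AE x in lborel. ?f x = 0"
      using integral_nonneg_eq_0_iff_AE[OF int] nonneg unfolding angular_mass_eq by simp
    then have "AE x in lebesgue. ?f x = 0" by (rule AE_completion)
    with AE_coordinate_planes have "AE x in lebesgue. x \<notin> {x. \<rho> x < 1}"
    proof eventually_elim
      fix x assume x: "x \<notin> coordinate_planes" "?f x = 0"
      then have "dual_norm \<Phi> (fst x) > 0" "\<rho> x > 0"
        by (auto simp: coordinate_planes_def intro!: dual_norm_pos[OF Phi] rho_pos)
      then have "angular p x > 0" by (simp add: angular_def)
      with x show "x \<notin> {x. \<rho> x < 1}" by (auto split: split_indicator_asm)
    qed
    moreover have op: "open {x. \<rho> x < 1}"
      by (intro open_Collect_less rho_continuous continuous_intros)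
    ultimately have "{x. \<rho> x < 1} \<in> null_sets lebesgue"
      by (subst AE_iff_null_sets) (auto intro: lborelD)
    then have "negligible {x. \<rho> x < 1}" by (simp add: negligible_iff_null_sets)
    moreover have "(0, 0) \<in> {x. \<rho> x < 1}"
      using alpha_pos by (simp add: rho_def dual_norm_zero[OF Phi] dual_norm_zero[OF Psi])
    ultimately show False using open_not_negligible[OF op] by blast
  qed
  moreover have "0 \<le> angular_mass p"
    unfolding angular_mass_eq using nonneg by simp
  ultimately show ?thesis by simp
qed

section \<open>The derivative along the generator of the dilations\<close>

text \<open>The integrand is the derivative of \<open>\<phi>\<close> along the orbit \<open>s \<mapsto> dilation \<alpha> s x\<close>. The orbit starts at the
  origin and has left the support of \<open>\<phi>\<close> once \<open>s\<close> reaches \<open>R / \<rho> x\<close>.\<close>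

lemma integral_along_dilation:
  assumes \<phi>: "test_function \<phi>" and R: "\<And>x. R \<le> \<rho> x \<Longrightarrow> x \<notin> closure {x. \<phi> x \<noteq> 0}"
    and "0 < R" "0 < \<rho> x"
  shows "(\<integral>s. indicator {0<..} s / s * frechet_derivative \<phi> (at (dilation \<alpha> s x)) (euler_field (dilation \<alpha> s x))
      \<partial>lborel) = - \<phi> 0"
proof -
  let ?D = "\<lambda>y. frechet_derivative \<phi> (at y)"
  \<comment> \<open>velocity of the orbit; \<open>0 powr \<alpha> = 0\<close> makes it continuous up to \<open>s = 0\<close>\<close>
  define v where "v s = (fst x, ((\<alpha> + 1) * s powr \<alpha>) *\<^sub>R snd x)" for s
  define T where "T = R / \<rho> x"
  have T: "0 < T" using assms by (simp add: T_def)
  have lin: "linear (?D y)" for y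
    using test_function_has_derivative[OF \<phi>] has_derivative_linear by blast
  have v: "euler_field (dilation \<alpha> s x) = s *\<^sub>R v s" if "0 < s" for s
    using that by (simp add: euler_field_def dilation_def v_def powr_add mult_ac)
  have late: "dilation \<alpha> s x \<notin> closure {x. \<phi> x \<noteq> 0}" if "T \<le> s" for s
  proof (rule R)
    have "0 < s" using that T by linarith
    then show "R \<le> \<rho> (dilation \<alpha> s x)"
      using that \<open>0 < \<rho> x\<close> unfolding rho_dilation[OF \<open>0 < s\<close>] by (simp add: T_def field_simps)
  qed
  have cont_dil: "continuous_on {0..T} (\<lambda>s. dilation \<alpha> s x)"
    unfolding dilation_def using alpha_pos by (intro continuous_intros continuous_on_powr') auto
  have cont_v: "continuous_on {0..T} v"
    unfolding v_def using alpha_pos by (intro continuous_intros continuous_on_powr') auto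
  have cont_phi: "continuous_on UNIV \<phi>"
    using test_function_has_derivative[OF \<phi>] has_derivative_continuous
    by (blast intro: continuous_at_imp_continuous_on)
  have deriv: "((\<lambda>s. \<phi> (dilation \<alpha> s x)) has_vector_derivative ?D (dilation \<alpha> s x) (v s)) (at s)"
    if "s \<in> {0<..<T}" for s
  proof -
    have "((\<lambda>s. s powr (\<alpha> + 1)) has_real_derivative (\<alpha> + 1) * s powr \<alpha>) (at s)"
      using has_real_derivative_powr[of s "\<alpha> + 1"] that by simp
    then have p: "((\<lambda>s. s powr (\<alpha> + 1)) has_derivative (\<lambda>h. h * ((\<alpha> + 1) * s powr \<alpha>))) (at s)"
      unfolding has_field_derivative_def
      by (rule has_derivative_eq_rhs) (simp add: fun_eq_iff mult.commute)
    have "((\<lambda>s. dilation \<alpha> s x) has_derivative (\<lambda>h. h *\<^sub>R v s)) (at s)"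
      unfolding dilation_def v_def
      by (rule has_derivative_eq_rhs[OF has_derivative_Pair[OF
            has_derivative_scaleR_left[OF has_derivative_ident] has_derivative_scaleR_left[OF p]]])
         (simp add: fun_eq_iff)
    from has_derivative_compose[OF this test_function_has_derivative[OF \<phi>]]
    show ?thesis unfolding has_vector_derivative_def by (simp add: linear_scale[OF lin])
  qed
  have int: "set_integrable lborel {0..T} (\<lambda>s. ?D (dilation \<alpha> s x) (v s))"
    by (intro borel_integrable_atLeastAtMost' test_function_derivative_continuous[OF \<phi>] cont_dil cont_v)
  have "(\<integral>s. indicator {0<..} s / s * ?D (dilation \<alpha> s x) (euler_field (dilation \<alpha> s x)) \<partial>lborel)
      = (\<integral>s. indicator {0<..} s * ?D (dilation \<alpha> s x) (v s) \<partial>lborel)"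
    by (intro Bochner_Integration.integral_cong refl)
       (auto simp: v linear_scale[OF lin] split: split_indicator)
  also have "\<dots> = (\<integral>s. indicator {0<..} s * (indicator {0..T} s *\<^sub>R ?D (dilation \<alpha> s x) (v s)) \<partial>lborel)"
    using test_function_derivative_zero(2)[OF \<phi> late]
    by (intro Bochner_Integration.integral_cong refl) (auto split: split_indicator)
  also have "\<dots> = (LINT s:{0..T}|lborel. ?D (dilation \<alpha> s x) (v s))"
    unfolding set_lebesgue_integral_def
  proof (rule integral_cong_AE)
    have "integrable lborel (\<lambda>s. indicator {0..T} s *\<^sub>R ?D (dilation \<alpha> s x) (v s))"
      using int unfolding set_integrable_def .
    then show [measurable]: "(\<lambda>s. indicator {0..T} s *\<^sub>R ?D (dilation \<alpha> s x) (v s)) \<in> borel_measurable lborel"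
      by (rule borel_measurable_integrable)
    show "(\<lambda>s. indicator {0<..} s * (indicator {0..T} s *\<^sub>R ?D (dilation \<alpha> s x) (v s))) \<in> borel_measurable lborel"
      by measurable
    show "AE s in lborel. indicator {0<..} s * (indicator {0..T} s *\<^sub>R ?D (dilation \<alpha> s x) (v s))
        = indicator {0..T} s *\<^sub>R ?D (dilation \<alpha> s x) (v s)"
      using AE_lborel_singleton[of "0::real"] by eventually_elim (auto split: split_indicator)
  qed
  also have "\<dots> = integral {0..T} (\<lambda>s. ?D (dilation \<alpha> s x) (v s))"
    by (rule set_borel_integral_eq_integral(2)[OF int])
  also have "\<dots> = \<phi> (dilation \<alpha> T x) - \<phi> (dilation \<alpha> 0 x)"
    using T deriv
    by (intro integral_unique fundamental_theorem_of_calculus_interior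
        continuous_on_compose2[OF cont_phi cont_dil]) auto
  also have "\<phi> (dilation \<alpha> T x) = 0"
    by (rule test_function_derivative_zero(1)[OF \<phi> late]) simp
  also have "dilation \<alpha> 0 x = 0" using alpha_pos by (simp add: dilation_def zero_prod_def)
  finally show ?thesis by simp
qed

text \<open>Polar coordinates reduce the integral to the orbits of the dilations. The angular factor is
  constant on each orbit, where the remaining integral is \<open>- \<phi> 0\<close>. Integrating over the unit ball
  leaves the angular mass.\<close>

lemma euler_derivative_integral:
  assumes \<phi>: "test_function \<phi>" and "0 \<le> p"
  defines "F \<equiv> \<lambda>x. angular p x * frechet_derivative \<phi> (at x) (euler_field x)"
  shows "integrable lborel (\<lambda>x. \<rho> x powr -homogeneous_dim * F x)" (is ?int)
    and "(\<integral>x. \<rho> x powr -homogeneous_dim * F x \<partial>lborel) =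
      - (homogeneous_dim * angular_mass p) * \<phi> 0" (is ?eq)
proof -
  let ?Q = homogeneous_dim
  let ?D = "\<lambda>y. frechet_derivative \<phi> (at y)"
  let ?K = "closure {x. \<phi> x \<noteq> 0}"
  have "compact (\<rho> ` ?K)"
    using \<phi> by (intro compact_continuous_image continuous_on_subset[OF rho_continuous])
      (auto simp: test_function_def)
  from compact_imp_bounded[OF this] obtain R0 where R0: "\<forall>y\<in>\<rho> ` ?K. norm y \<le> R0"
    unfolding bounded_iff by blast
  define R where "R = \<bar>R0\<bar> + 1"
  have "0 < R" by (simp add: R_def)
  have R: "x \<notin> ?K" if "R \<le> \<rho> x" for x
  proof
    assume "x \<in> ?K"
    then have "norm (\<rho> x) \<le> R0" using R0 by blast
    then show False using that by (simp add: R_def)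
  qed
  have D0: "?D x v = 0" if "R \<le> \<rho> x" for x v
    using test_function_derivative_zero(2)[OF \<phi> R[OF that]] by simp
  obtain L where L: "0 < L" "\<And>x. \<rho> x < R \<Longrightarrow> norm (euler_field x) \<le> L * \<rho> x"
    using norm_euler_field_le by metis
  obtain M where M: "0 < M" "\<And>x v. \<bar>?D x v\<bar> \<le> M * norm v"
    using test_function_derivative_bound[OF \<phi>] by metis
  have "continuous_on UNIV (\<lambda>x. ?D x (euler_field x))"
    by (rule test_function_derivative_continuous[OF \<phi>])
       (auto simp: euler_field_def intro!: continuous_intros)
  then have [measurable]: "(\<lambda>x. ?D x (euler_field x)) \<in> borel_measurable borel"
    by (rule borel_measurable_continuous_onI)
  have F: "F \<in> borel_measurable borel" unfolding F_def by measurable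
  have bound: "norm (F x) \<le> M * L * \<rho> x" for x
  proof (cases "\<rho> x < R")
    case True
    have "norm (F x) \<le> 1 * \<bar>?D x (euler_field x)\<bar>"
      unfolding F_def real_norm_def abs_mult
      using angular_nonneg[of p x] angular_le_1[OF \<open>0 \<le> p\<close>, of x] by (intro mult_right_mono) auto
    also have "\<dots> \<le> M * norm (euler_field x)" using M by simp
    also have "\<dots> \<le> M * (L * \<rho> x)" using M L(2)[OF True] by (intro mult_left_mono) auto
    finally show ?thesis by simp
  next
    case False
    then show ?thesis using M L rho_nonneg[of x] by (simp add: F_def D0)
  qed
  have "integrable lborel (\<lambda>x. \<rho> x powr -?Q *\<^sub>R F x)"
    by (rule integrable_rho_powr[OF F bound]) (use \<open>0 < R\<close> M L in \<open>auto simp: F_def D0\<close>)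
  then show ?int by simp
  have "(\<integral>x. \<rho> x powr -?Q * F x \<partial>lborel) =
      (\<integral>x. \<integral>s. polar_density \<rho> ?Q (x, s) * F (dilation \<alpha> s x) \<partial>lborel \<partial>lborel)"
    by (rule integral_polar[OF rho_measurable rho_dilation AE_rho_pos homogeneous_dim_def
          homogeneous_dim_pos F \<open>?int\<close>])
  also have "\<dots> = (\<integral>x. - (?Q * \<phi> 0) * (indicator {x. \<rho> x < 1} x * angular p x) \<partial>lborel)"
  proof (rule integral_cong_AE)
    show "AE x in lborel. (\<integral>s. polar_density \<rho> ?Q (x, s) * F (dilation \<alpha> s x) \<partial>lborel) =
        - (?Q * \<phi> 0) * (indicator {x. \<rho> x < 1} x * angular p x)"
      using AE_rho_pos
    proof eventually_elim
      fix x assume x: "0 < \<rho> x"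
      have line: "(\<integral>s. indicator {0<..} s / s * ?D (dilation \<alpha> s x) (euler_field (dilation \<alpha> s x)) \<partial>lborel) = - \<phi> 0"
        by (rule integral_along_dilation[OF \<phi> _ \<open>0 < R\<close> x]) (rule R)
      have "(\<integral>s. polar_density \<rho> ?Q (x, s) * F (dilation \<alpha> s x) \<partial>lborel) =
        (\<integral>s. (?Q * indicator {x. \<rho> x < 1} x * angular p x) *
          (indicator {0<..} s / s * ?D (dilation \<alpha> s x) (euler_field (dilation \<alpha> s x))) \<partial>lborel)"
        by (intro Bochner_Integration.integral_cong refl)
           (auto simp: polar_density_def F_def angular_dilation split: split_indicator)
      also have "\<dots> = (?Q * indicator {x. \<rho> x < 1} x * angular p x) * (- \<phi> 0)"
        unfolding integral_mult_right_zero line ..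
      finally show "(\<integral>s. polar_density \<rho> ?Q (x, s) * F (dilation \<alpha> s x) \<partial>lborel) =
        - (?Q * \<phi> 0) * (indicator {x. \<rho> x < 1} x * angular p x)" by simp
    qed
    have [measurable]: "(\<lambda>(x, s). F (dilation \<alpha> s x)) \<in> borel_measurable (borel \<Otimes>\<^sub>M borel)"
      using measurable_compose[OF dilation_measurable(1) F] by (simp add: case_prod_beta')
    show "(\<lambda>x. \<integral>s. polar_density \<rho> ?Q (x, s) * F (dilation \<alpha> s x) \<partial>lborel) \<in> borel_measurable lborel"
      by measurable
  qed measurable
  also have "\<dots> = - (?Q * angular_mass p) * \<phi> 0"
    unfolding angular_mass_eq by simp
  finally show ?eq .
qed

section \<open>The fundamental solution\<close>

text \<open>The derivative of the profile is negative, and the \<open>(p - 1)\<close>-st power of its modulus is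
  \<open>1 / S * \<rho> powr (1 - Q)\<close>. With the factor \<open>1 / \<rho>\<close> from the radial flux this gives \<open>\<rho> powr -Q\<close>,
  the density of a dilation-invariant measure.\<close>

lemma flux_fundamental:
  fixes p S :: real
  assumes x: "x \<notin> coordinate_planes" and "0 < S" "1 < p"
    and g: "(g has_real_derivative - (S powr (-1 / (p - 1)) * \<rho> x powr (- (homogeneous_dim - 1) / (p - 1)))) (at (\<rho> x))"
  shows "flux \<Phi> \<Psi> \<alpha> p (\<lambda>y. g (\<rho> y)) x =
    (- (1 / S)) *\<^sub>R (\<rho> x powr -homogeneous_dim *\<^sub>R angular p x *\<^sub>R euler_field x)"
proof -
  let ?Q = homogeneous_dim
  define m where "m = S powr (-1 / (p - 1)) * \<rho> x powr (- (?Q - 1) / (p - 1))"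
  have x': "fst x \<noteq> 0" "snd x \<noteq> 0" using x by (auto simp: coordinate_planes_def)
  then have r: "0 < \<rho> x" by (intro rho_pos) auto
  have m: "0 < m" using \<open>0 < S\<close> r by (simp add: m_def)
  have "m powr (p - 2) * m = m powr (p - 1)"
    using m powr_add[of m "p - 2" 1] by simp
  also have "\<dots> = S powr (-1) * \<rho> x powr (- (?Q - 1))"
    using \<open>1 < p\<close> unfolding m_def by (subst powr_mult) (simp_all add: powr_powr)
  also have "\<dots> = 1 / S * (\<rho> x powr (-?Q) * \<rho> x)"
    using \<open>0 < S\<close> r powr_add[of "\<rho> x" "-?Q" 1] by (simp add: powr_minus field_simps)
  finally have "\<bar>- m\<bar> powr (p - 2) * (- m) * angular p x / \<rho> x = - (1 / S) * (\<rho> x powr (-?Q) * angular p x)"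
    using m r by simp
  then show ?thesis
    using flux_radial[OF x' g] unfolding m_def[symmetric] angular_def[symmetric] euler_field_def[symmetric]
    by simp
qed

text \<open>The derivative of the profile alone matters, so powers and the logarithm are treated together.
  Each of the three clauses is checked off the coordinate planes, where the flux has its
  explicit form.\<close>

theorem fundamental_solution_radial:
  fixes p :: real and g :: "real \<Rightarrow> real"
  assumes "1 < p"
    and g: "\<And>r. 0 < r \<Longrightarrow> (g has_real_derivative
      - ((homogeneous_dim * angular_mass p) powr (-1 / (p - 1)) * r powr (- (homogeneous_dim - 1) / (p - 1)))) (at r)"
  shows "fundamental_solution \<Phi> \<Psi> \<alpha> p (\<lambda>x. g (\<rho> x))"
proof -
  let ?Q = homogeneous_dim and ?u = "\<lambda>x. g (\<rho> x)"
  define S where "S = ?Q * angular_mass p"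
  have S: "0 < S" using \<open>1 < p\<close> homogeneous_dim_pos angular_mass_pos[of p] by (simp add: S_def)
  define V where "V x = (- (1 / S)) *\<^sub>R (\<rho> x powr -?Q *\<^sub>R angular p x *\<^sub>R euler_field x)" for x
  have r: "0 < \<rho> x" if "x \<notin> coordinate_planes" for x
    using that by (intro rho_pos) (auto simp: coordinate_planes_def)
  have flux: "flux \<Phi> \<Psi> \<alpha> p ?u x = V x" if "x \<notin> coordinate_planes" for x
    unfolding V_def using flux_fundamental[OF that S \<open>1 < p\<close>] g[OF r[OF that]] by (simp add: S_def)
  have diff: "(\<lambda>z. ?u (z, snd x)) differentiable (at (fst x)) \<and> (\<lambda>\<sigma>. ?u (fst x, \<sigma>)) differentiable (at (snd x))"
    if "x \<notin> coordinate_planes" for x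
  proof -
    have x: "fst x \<noteq> 0" "snd x \<noteq> 0" using that by (auto simp: coordinate_planes_def)
    obtain \<xi> where \<xi>: "\<Phi> \<xi> = 1" "dual_norm \<Phi> (fst x) = fst x \<bullet> \<xi>"
      using dual_norm_attained[OF Phi] by metis
    obtain \<eta> where \<eta>: "\<Psi> \<eta> = 1" "dual_norm \<Psi> (snd x) = snd x \<bullet> \<eta>"
      using dual_norm_attained[OF Psi] by metis
    note g' = g[OF r[OF that]]
    show ?thesis
      using GDERIV_DERIV_compose[OF rho_GDERIV_fst[OF x(1) \<xi>(1) \<xi>(2)[symmetric]], of g] g'
        GDERIV_DERIV_compose[OF rho_GDERIV_snd[OF x(2) \<eta>(1) \<eta>(2)[symmetric]], of g]
      unfolding gderiv_def differentiable_def by (metis prod.collapse)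
  qed
  have integ: "flux \<Phi> \<Psi> \<alpha> p ?u absolutely_integrable_on K" if K: "compact K" for K
  proof -
    have "compact (\<rho> ` K)"
      by (intro compact_continuous_image continuous_on_subset[OF rho_continuous] K) auto
    from compact_imp_bounded[OF this] obtain R0 where R0: "\<forall>y\<in>\<rho> ` K. norm y \<le> R0"
      unfolding bounded_iff by blast
    have R: "\<rho> x < \<bar>R0\<bar> + 1" if "x \<in> K" for x using R0 that rho_nonneg[of x] by force
    obtain L where L: "0 < L" "\<And>x. \<rho> x < \<bar>R0\<bar> + 1 \<Longrightarrow> norm (euler_field x) \<le> L * \<rho> x"
      using norm_euler_field_le by metis
    have [measurable]: "K \<in> sets borel" using K by (simp add: borel_compact)
    have "integrable lborel (\<lambda>x. \<rho> x powr -?Q *\<^sub>R (indicator K x *\<^sub>R angular p x *\<^sub>R euler_field x))"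
    proof (rule integrable_rho_powr)
      show "(\<lambda>x. indicator K x *\<^sub>R angular p x *\<^sub>R euler_field x) \<in> borel_measurable borel"
        by measurable
      show "norm (indicator K x *\<^sub>R angular p x *\<^sub>R euler_field x) \<le> L * \<rho> x" for x
      proof (cases "x \<in> K")
        case True
        have "norm (indicator K x *\<^sub>R angular p x *\<^sub>R euler_field x) \<le> 1 * norm (euler_field x)"
          using True angular_nonneg[of p x] angular_le_1[of p x] \<open>1 < p\<close> by (simp add: mult_left_le_one_le)
        also have "\<dots> \<le> L * \<rho> x" using L(2)[OF R[OF True]] by simp
        finally show ?thesis .
      qed (use L rho_nonneg[of x] in simp)
      show "indicator K x *\<^sub>R angular p x *\<^sub>R euler_field x = 0" if "\<bar>R0\<bar> + 1 \<le> \<rho> x" for x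
        using R[of x] that by (auto split: split_indicator)
    qed (use L in auto)
    then have "integrable lborel (\<lambda>x. (- (1 / S)) *\<^sub>R (\<rho> x powr -?Q *\<^sub>R (indicator K x *\<^sub>R angular p x *\<^sub>R euler_field x)))"
      by (rule integrable_scaleR_right)
    also have "(\<lambda>x. (- (1 / S)) *\<^sub>R (\<rho> x powr -?Q *\<^sub>R (indicator K x *\<^sub>R angular p x *\<^sub>R euler_field x)))
        = (\<lambda>x. indicator K x *\<^sub>R V x)"
      by (simp add: V_def mult_ac)
    finally have "V absolutely_integrable_on K"
      unfolding set_integrable_def by (subst integrable_completion) (auto dest: borel_measurable_integrable)
    then show ?thesis
      by (rule absolutely_integrable_spike[OF _ negligible_coordinate_planes]) (auto simp: flux)
  qed
  have weak: "(LINT x|lebesgue. flux \<Phi> \<Psi> \<alpha> p ?u x \<bullet> (grad_fst \<phi> x, grad_snd \<phi> x)) = \<phi> 0"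
    if \<phi>: "test_function \<phi>" for \<phi>
  proof -
    let ?F = "\<lambda>x. \<rho> x powr -?Q * (angular p x * frechet_derivative \<phi> (at x) (euler_field x))"
    have p: "0 \<le> p" using \<open>1 < p\<close> by simp
    have int: "integrable lborel (\<lambda>x. - (1 / S) * ?F x)"
      using euler_derivative_integral(1)[OF \<phi> p] by (rule integrable_mult_right)
    have lin: "linear (frechet_derivative \<phi> (at x))" for x
      using test_function_has_derivative[OF \<phi>] has_derivative_linear by blast
    have V: "V x \<bullet> (grad_fst \<phi> x, grad_snd \<phi> x) = - (1 / S) * ?F x" for x
      unfolding V_def inner_scaleR_left
        inner_partial_gradients[OF test_function_has_derivative[OF \<phi>]]
      by (simp add: linear_scale[OF lin] linear_neg[OF lin])
    have eq: "flux \<Phi> \<Psi> \<alpha> p ?u x \<bullet> (grad_fst \<phi> x, grad_snd \<phi> x) = - (1 / S) * ?F x"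
      if "x \<in> UNIV - coordinate_planes" for x
      using that flux[of x] V by auto
    have int': "(\<lambda>x. - (1 / S) * ?F x) absolutely_integrable_on UNIV"
      unfolding set_integrable_def using int
      by (subst integrable_completion) (auto dest: borel_measurable_integrable)
    have "(\<lambda>x. flux \<Phi> \<Psi> \<alpha> p ?u x \<bullet> (grad_fst \<phi> x, grad_snd \<phi> x)) absolutely_integrable_on UNIV"
      by (rule absolutely_integrable_spike[OF int' negligible_coordinate_planes eq])
    then have "(LINT x|lebesgue. flux \<Phi> \<Psi> \<alpha> p ?u x \<bullet> (grad_fst \<phi> x, grad_snd \<phi> x))
        = (LINT x|lebesgue. - (1 / S) * ?F x)"
      using int' AE_coordinate_planes eq
      by (intro integral_cong_AE) (auto simp: set_integrable_def dest: borel_measurable_integrable elim: eventually_mono)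
    also have "\<dots> = (LINT x|lborel. - (1 / S) * ?F x)"
      using int by (intro integral_completion) (auto dest: borel_measurable_integrable)
    also have "\<dots> = - (1 / S) * (LINT x|lborel. ?F x)" by simp
    also have "\<dots> = \<phi> 0"
      unfolding euler_derivative_integral(2)[OF \<phi> p] S_def[symmetric] using S by simp
    finally show ?thesis .
  qed
  show ?thesis
    unfolding fundamental_solution_def
  proof (intro conjI allI impI)
    show "AE x in lebesgue. (\<lambda>z. ?u (z, snd x)) differentiable (at (fst x)) \<and>
        (\<lambda>\<sigma>. ?u (fst x, \<sigma>)) differentiable (at (snd x))"
      using AE_coordinate_planes by eventually_elim (rule diff)
  qed (rule integ weak, assumption)+
qed

end

theorem theorem1p4:
  fixes \<Phi> :: "real ^ 'm \<Rightarrow> real" and \<Psi> :: "real ^ 'k \<Rightarrow> real" and \<alpha> p :: real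
  assumes "minkowski_norm \<Phi>" and "Ck_on 2 \<Phi> (- {0})"
    and "minkowski_norm \<Psi>" and "Ck_on 2 \<Psi> (- {0})"
    and "\<alpha> > 0" and "1 < p"
  shows "fundamental_solution \<Phi> \<Psi> \<alpha> p (G_fun \<Phi> \<Psi> \<alpha> p)"
proof -
  interpret grushin_gauge \<Phi> \<Psi> \<alpha>
    by unfold_locales (use assms in \<open>auto simp: numeral_2_eq_2\<close>)
  have Q: "hom_dim TYPE('m) TYPE('k) \<alpha> = homogeneous_dim"
    by (simp add: hom_dim_def homogeneous_dim_def)
  have \<omega>: "omega_const \<Phi> \<Psi> \<alpha> p = angular_mass p"
    by (simp add: omega_const_def angular_mass_def angular_def)
  define S where "S = homogeneous_dim * angular_mass p"
  have sigma: "sigma_const \<Phi> \<Psi> \<alpha> p = S" by (simp add: sigma_const_def Q \<omega> S_def)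
  let ?Q = homogeneous_dim
  show ?thesis
  proof (cases "p = ?Q")
    case False
    define g where "g r = (p - 1) / (?Q - p) * S powr (- 1 / (p - 1)) * r powr (- (?Q - p) / (p - 1))" for r
    have "fundamental_solution \<Phi> \<Psi> \<alpha> p (\<lambda>x. g (\<rho> x))"
    proof (rule fundamental_solution_radial[OF \<open>1 < p\<close>, folded S_def])
      fix r :: real assume "0 < r"
      have e: "- (?Q - p) / (p - 1) - 1 = - (?Q - 1) / (p - 1)"
        using \<open>1 < p\<close> by (simp add: field_simps)
      have "((\<lambda>r. r powr (- (?Q - p) / (p - 1))) has_real_derivative
          - (?Q - p) / (p - 1) * r powr (- (?Q - 1) / (p - 1))) (at r)"
        using has_real_derivative_powr[OF \<open>0 < r\<close>, of "- (?Q - p) / (p - 1)"] unfolding e .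
      from DERIV_cmult[OF this, of "(p - 1) / (?Q - p) * S powr (- 1 / (p - 1))"]
      show "(g has_real_derivative - (S powr (-1 / (p - 1)) * r powr (- (?Q - 1) / (p - 1)))) (at r)"
        unfolding g_def[abs_def]
      proof (rule DERIV_cong)
        have "(p - 1) / (?Q - p) * (- (?Q - p) / (p - 1)) = -1"
          using \<open>1 < p\<close> False by (simp add: divide_simps)
        then have "(p - 1) / (?Q - p) * (- (?Q - p) / (p - 1)) * (S powr (- 1 / (p - 1)) * r powr (- (?Q - 1) / (p - 1)))
            = - (S powr (- 1 / (p - 1)) * r powr (- (?Q - 1) / (p - 1)))"
          by (simp only: mult_minus1)
        then show "(p - 1) / (?Q - p) * S powr (- 1 / (p - 1)) * (- (?Q - p) / (p - 1) * r powr (- (?Q - 1) / (p - 1)))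
            = - (S powr (- 1 / (p - 1)) * r powr (- (?Q - 1) / (p - 1)))"
          by (simp only: ac_simps)
      qed
    qed
    moreover have "G_fun \<Phi> \<Psi> \<alpha> p = (\<lambda>x. g (\<rho> x))"
      using False by (simp add: fun_eq_iff G_fun_def C_const_def Q sigma g_def Let_def)
    ultimately show ?thesis by simp
  next
    case True
    define g where "g r = - (S powr (- 1 / (p - 1))) * ln r" for r
    have "fundamental_solution \<Phi> \<Psi> \<alpha> p (\<lambda>x. g (\<rho> x))"
    proof (rule fundamental_solution_radial[OF \<open>1 < p\<close>, folded S_def])
      fix r :: real assume "0 < r"
      have "- (?Q - 1) / (p - 1) = -1" using \<open>1 < p\<close> True by (simp add: field_simps)
      then have e: "r powr (- (?Q - 1) / (p - 1)) = 1 / r"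
        using \<open>0 < r\<close> by (simp only: powr_minus_divide) simp
      show "(g has_real_derivative - (S powr (-1 / (p - 1)) * r powr (- (?Q - 1) / (p - 1)))) (at r)"
        unfolding g_def[abs_def] e using \<open>0 < r\<close> by (auto intro!: derivative_eq_intros)
    qed
    moreover have "G_fun \<Phi> \<Psi> \<alpha> p = (\<lambda>x. g (\<rho> x))"
      using True[symmetric] sigma by (simp add: fun_eq_iff G_fun_def C_const_def Q g_def Let_def)
    ultimately show ?thesis by simp
  qed
qed

end
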